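(* Let $\mathcal X$ be a finite set of covariate paths $x=(x_1,\dots,x_T)$. (a) Let $(X,V,A)$ be a random element of $\mathcal X\times\mathbb R^T\times\mathbb R$ whose distribution satisfies sequential exogeneity: $V_t\mid(A,X^t)\overset{d}{=}V_1\mid(A,X_1)$ for $t=2,\dots,T$. Put $\tilde V_t=A-V_t$ and $\nu=\Pr(X=\cdot\mid A)$. Then the distribution of $(X,\tilde V,\nu)$ belongs to $\Gamma_\beta$. (b) If the distribution of a random element $(X,\tilde V,\nu)$ of $\mathcal X\times\mathbb R^T\times\Delta$ belongs to $\Gamma_\beta$, then there is a measurable real-valued function $A$ of $\nu$ such that, with $V_t=A-\tilde V_t$, the distribution of $(X,V,A)$ satisfies sequential exogeneity, $V_t\mid(A,X^t)\overset{d}{=}V_1\mid(A,X_1)$ for $t=2,\dots,T$, and $\Pr(X=\cdot\mid A)=\nu$ almost surely.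
   Context: $X=(X_1,\dots,X_T)$ takes values in the finite set $\mathcal X$, and $X^t=(X_1,\dots,X_t)$, $x^t=(x_1,\dots,x_t)$ denote histories through period $t$. The notation $V_t\mid(A,X^t)\overset{d}{=}V_1\mid(A,X_1)$ means that the regular conditional distribution of $V_t$ given $(A,X^t)$ equals that of $V_1$ given $(A,X_1)$ almost surely. $\Delta=\{\nu\in\mathbb R_+^{\mathcal X}:\sum_{x\in\mathcal X}\nu(x)=1\}$. For $\nu\in\Delta$, $\nu_t(x^t)=\sum_{\tilde x\in\mathcal X:\ \tilde x^t=x^t}\nu(\tilde x)$ is the probability of the history $x^t$ under $\nu$. $\Gamma_\beta$ is the set of probability measures $\gamma$ on $\mathcal W=\mathcal X\times\mathbb R^T\times\Delta$ (laws of $(X,\tilde V,\nu)$) such that, for all $x\in\mathcal X$, all $t\in\{2,\dots,T\}$, all histories $x^t$, and all bounded measurable $r:\Delta\to\mathbb R$ and $f:\mathbb R\to\mathbb R$, $$\mathbb E_\gamma\bigl[r(\nu)(1\{X=x\}-\nu(x))\bigr]=0,$$ $$\mathbb E_\gamma\bigl[r(\nu)\bigl(f(\tilde V_t)1\{X^t=x^t\}\nu_1(x_1)-f(\tilde V_1)1\{X_1=x_1\}\nu_t(x^t)\bigr)\bigr]=0.$$ ($\Gamma_\beta$ is indexed by the coefficient $\beta$ but these restrictions do not involve it.) *)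

theory Defs
  imports "HOL-Probability.Probability"
begin

text \<open>
  A covariate path \<open>(x\<^sub>1, \<dots>, x\<^sub>T)\<close> is an extensional function on \<open>{1..T}\<close>, and the
  set of paths is a finite set \<open>\<X> \<subseteq> {1..T} \<rightarrow>\<^sub>E UNIV\<close>. Likewise \<open>\<real>\<^sup>T\<close> is the product
  space \<open>\<Pi>\<^sub>M t\<in>{1..T}. borel\<close>.
\<close>

definition history :: "nat \<Rightarrow> (nat \<Rightarrow> 'c) \<Rightarrow> nat \<Rightarrow> 'c" where
  "history t x = restrict x {1..t}"

definition prob_simplex :: "'p set \<Rightarrow> ('p \<Rightarrow> real) set" where
  "prob_simplex \<X> = {\<nu> \<in> \<X> \<rightarrow>\<^sub>E {0..}. (\<Sum>x\<in>\<X>. \<nu> x) = 1}"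

definition simplex_space :: "'p set \<Rightarrow> ('p \<Rightarrow> real) measure" where
  "simplex_space \<X> = restrict_space (\<Pi>\<^sub>M x\<in>\<X>. borel) (prob_simplex \<X>)"

definition history_prob ::
    "(nat \<Rightarrow> 'c) set \<Rightarrow> ((nat \<Rightarrow> 'c) \<Rightarrow> real) \<Rightarrow> nat \<Rightarrow> (nat \<Rightarrow> 'c) \<Rightarrow> real" where
  "history_prob \<X> \<nu> t h = (\<Sum>x\<in>{x\<in>\<X>. history t x = h}. \<nu> x)"

definition law_space ::
    "nat \<Rightarrow> (nat \<Rightarrow> 'c) set \<Rightarrow>
      ((nat \<Rightarrow> 'c) \<times> (nat \<Rightarrow> real) \<times> ((nat \<Rightarrow> 'c) \<Rightarrow> real)) measure" where
  "law_space T \<X> = count_space \<X> \<Otimes>\<^sub>M ((\<Pi>\<^sub>M t\<in>{1..T}. borel) \<Otimes>\<^sub>M simplex_space \<X>)"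

text \<open>
  In the model this set of laws carries the coefficient \<open>\<beta>\<close> as an index, but its defining
  restrictions do not involve \<open>\<beta>\<close>, so there is no such parameter. All integrands below are
  bounded and measurable, so the Bochner integrals are genuine expectations.
\<close>

definition Gamma_laws ::
    "nat \<Rightarrow> (nat \<Rightarrow> 'c) set \<Rightarrow>
      ((nat \<Rightarrow> 'c) \<times> (nat \<Rightarrow> real) \<times> ((nat \<Rightarrow> 'c) \<Rightarrow> real)) measure set" where
  "Gamma_laws T \<X> = {\<gamma>. prob_space \<gamma> \<and> sets \<gamma> = sets (law_space T \<X>) \<and>
     (\<forall>r \<in> borel_measurable (simplex_space \<X>). bounded (r ` prob_simplex \<X>) \<longrightarrow>
       (\<forall>x\<in>\<X>. (\<integral>(X, V, \<nu>). r \<nu> * (of_bool (X = x) - \<nu> x) \<partial>\<gamma>) = 0) \<and>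
       (\<forall>f \<in> borel_measurable borel. bounded (range f) \<longrightarrow>
         (\<forall>x\<in>\<X>. \<forall>t\<in>{2..T}.
           (\<integral>(X, V, \<nu>). r \<nu> *
               (f (V t) * of_bool (history t X = history t x) * history_prob \<X> \<nu> 1 (history 1 x)
                - f (V 1) * of_bool (X 1 = x 1) * history_prob \<X> \<nu> t (history t x)) \<partial>\<gamma>)
             = (0::real))))}"

definition regular_cond_distr ::
    "'w measure \<Rightarrow> 'y measure \<Rightarrow> ('w \<Rightarrow> 'y) \<Rightarrow> 'z measure \<Rightarrow> ('w \<Rightarrow> 'z) \<Rightarrow>
      ('z \<Rightarrow> 'y measure) \<Rightarrow> bool" where
  "regular_cond_distr M L Y N Z \<kappa> \<longleftrightarrow>
     \<kappa> \<in> N \<rightarrow>\<^sub>M prob_algebra L \<and>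
     (\<forall>B\<in>sets L. AE \<omega> in M.
        measure (\<kappa> (Z \<omega>)) B =
        real_cond_exp M (vimage_algebra (space M) Z N) (indicator (Y -` B \<inter> space M)) \<omega>)"

text \<open>
  Regular conditional distributions of real random variables exist and are unique up to
  null sets, so equality of some pair of versions is equality of all of them.
\<close>

definition same_cond_distr ::
    "'w measure \<Rightarrow> 'y measure \<Rightarrow> ('w \<Rightarrow> 'y) \<Rightarrow> 'z measure \<Rightarrow> ('w \<Rightarrow> 'z) \<Rightarrow>
      ('w \<Rightarrow> 'y) \<Rightarrow> 'z' measure \<Rightarrow> ('w \<Rightarrow> 'z') \<Rightarrow> bool" where
  "same_cond_distr M L Y N Z Y' N' Z' \<longleftrightarrow>
     (\<exists>\<kappa> \<kappa>'. regular_cond_distr M L Y N Z \<kappa> \<and> regular_cond_distr M L Y' N' Z' \<kappa>' \<and>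
       (AE \<omega> in M. \<kappa> (Z \<omega>) = \<kappa>' (Z' \<omega>)))"

definition sequentially_exogenous ::
    "nat \<Rightarrow> (nat \<Rightarrow> 'c) set \<Rightarrow> 'w measure \<Rightarrow> ('w \<Rightarrow> nat \<Rightarrow> 'c) \<Rightarrow> ('w \<Rightarrow> nat \<Rightarrow> real) \<Rightarrow>
      ('w \<Rightarrow> real) \<Rightarrow> bool" where
  "sequentially_exogenous T \<X> M X V A \<longleftrightarrow>
     (\<forall>t\<in>{2..T}. same_cond_distr M borel
        (\<lambda>\<omega>. V \<omega> t) (borel \<Otimes>\<^sub>M count_space (history t ` \<X>)) (\<lambda>\<omega>. (A \<omega>, history t (X \<omega>)))
        (\<lambda>\<omega>. V \<omega> 1) (borel \<Otimes>\<^sub>M count_space ((\<lambda>x. x 1) ` \<X>)) (\<lambda>\<omega>. (A \<omega>, X \<omega> 1)))"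

definition is_cond_prob_path ::
    "'p set \<Rightarrow> 'w measure \<Rightarrow> ('w \<Rightarrow> 'p) \<Rightarrow> ('w \<Rightarrow> real) \<Rightarrow> ('w \<Rightarrow> 'p \<Rightarrow> real) \<Rightarrow> bool" where
  "is_cond_prob_path \<X> M X A \<nu> \<longleftrightarrow>
     (AE \<omega> in M. \<forall>x\<in>\<X>.
        real_cond_exp M (vimage_algebra (space M) A borel)
          (indicator {\<omega> \<in> space M. X \<omega> = x}) \<omega> = \<nu> \<omega> x)"

end

theory Submission imports Defs begin

text \<open>
  Both directions rest on one identity. Given \<open>A\<close>, the events \<open>X\<^sub>1 = x\<^sub>1\<close> and \<open>X\<^sup>t = x\<^sup>t\<close> have the
  probabilities \<open>\<nu>\<^sub>1(x\<^sub>1)\<close> and \<open>\<nu>\<^sub>t(x\<^sup>t)\<close>, so sequential exogeneity says that \<open>(A, V\<^sub>t)\<close> weighted by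
  \<open>1{X\<^sup>t = x\<^sup>t} \<nu>\<^sub>1(x\<^sub>1)\<close> and \<open>(A, V\<^sub>1)\<close> weighted by \<open>1{X\<^sub>1 = x\<^sub>1} \<nu>\<^sub>t(x\<^sup>t)\<close> have the same distribution.
  Equality on rectangles extends to all bounded functions, which permits the change of variables
  between \<open>V\<close> and \<open>A - V\<close>. For the converse, \<open>A\<close> is a real number encoding which of countably many
  generating events contain \<open>\<nu>\<close>, so that \<open>A\<close> and \<open>\<nu>\<close> generate the same \<open>\<sigma>\<close>-algebra.
\<close>

text \<open>The restrictions of \<open>Gamma_laws\<close> are cross-multiplied. Both sides describe
  one measure, \<nu>_1(x_1) \<nu>_t(x^t) times the conditional law of the error given A and x_1, so
  no ratio of possibly vanishing probabilities occurs. Division happens only in the converse and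
  only at the realized X_1, where \<nu>_1(X_1) > 0 almost surely.

  Two obstacles shape the proof. First, \<open>same_cond_distr\<close> asks for kernels, while the
  restrictions yield only integrals; the converse therefore needs a regular conditional distribution
  to be built, here from conditional expectations at half-lines. Second, the restrictions test only
  functions of \<nu>, while exogeneity conditions on the scalar A. In the converse A must be a
  function of \<nu>, so that its events can be tested, and must lose no information, since otherwise
  Pr(X = . | A) would be an average of \<nu> and not \<nu> itself. In the direct half A may know
  more than \<nu>; there it suffices that r(\<nu>) is measurable in A, for a suitable version of
  \<nu>.\<close>

section \<open>Regular conditional distributions of real random variables\<close>

lemma (in prob_space) subalgebra_vimage:
  assumes Z: "Z \<in> M \<rightarrow>\<^sub>M N"
  shows "subalgebra M (vimage_algebra (space M) Z N)"
    and "sigma_finite_subalgebra M (vimage_algebra (space M) Z N)"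
proof -
  show *: "subalgebra M (vimage_algebra (space M) Z N)"
    unfolding subalgebra_def using measurable_sets[OF Z] measurable_space[OF Z]
    by (auto simp: sets_vimage_algebra2)
  show "sigma_finite_subalgebra M (vimage_algebra (space M) Z N)"
    by (rule finite_measure_subalgebra_is_sigma_finite)
      (use * in \<open>auto simp: finite_measure_subalgebra_def finite_measure_axioms finite_measure_subalgebra_axioms_def\<close>)
qed

lemma (in prob_space) integrable_boundedI:
  fixes f :: "'a \<Rightarrow> real"
  assumes "f \<in> borel_measurable M" "\<And>\<omega>. \<omega> \<in> space M \<Longrightarrow> \<bar>f \<omega>\<bar> \<le> c"
  shows "integrable M f"
  using assms by (intro integrable_const_bound[where B=c]) auto

lemma vimage_algebra_fst_factor:
  assumes f: "f \<in> vimage_algebra (space N \<times> space L) fst N \<rightarrow>\<^sub>M (borel :: real measure)"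
    and y: "y \<in> space L"
  shows "(\<lambda>z. f (z, y)) \<in> borel_measurable N"
    and "\<And>z y'. z \<in> space N \<Longrightarrow> y' \<in> space L \<Longrightarrow> f (z, y') = f (z, y)"
proof -
  have "(\<lambda>z. (z, y)) \<in> N \<rightarrow>\<^sub>M vimage_algebra (space N \<times> space L) fst N"
    using y by (intro measurable_vimage_algebra2) auto
  from measurable_compose[OF this f] show "(\<lambda>z. f (z, y)) \<in> borel_measurable N" .
  fix z y' assume z: "z \<in> space N" "y' \<in> space L"
  have "f -` {f (z, y)} \<inter> (space N \<times> space L) \<in> sets (vimage_algebra (space N \<times> space L) fst N)"
    using measurable_sets[OF f, of "{f (z, y)}"] by simp
  then obtain C where "f -` {f (z, y)} \<inter> (space N \<times> space L) = fst -` C \<inter> (space N \<times> space L)"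
    by (subst (asm) sets_vimage_algebra2) auto
  then have "(z, v) \<in> f -` {f (z, y)} \<inter> (space N \<times> space L) \<longleftrightarrow> z \<in> C" if "v \<in> space L" for v
    using z that by simp
  from this[OF y] this[OF z(2)] z y show "f (z, y') = f (z, y)" by simp
qed

text \<open>
  No monotonicity of \<open>F\<close> is assumed: the infimum over the shrinking sets \<open>\<rat> \<inter> (x, \<infinity>)\<close> is
  automatically nondecreasing and right-continuous, so the kernel below needs no exceptional null set.
\<close>

lemma interval_measure_INF_rat:
  fixes F :: "real \<Rightarrow> real"
  assumes F: "\<And>q. 0 \<le> F q" "\<And>q. F q \<le> 1" "\<And>q. q < a \<Longrightarrow> F q = 0" "\<And>q. b \<le> q \<Longrightarrow> F q = 1"
  defines "H \<equiv> \<lambda>x. INF q\<in>{q\<in>\<rat>. x < q}. F q"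
  shows "real_distribution (interval_measure H)"
    and "measure (interval_measure H) {..x} = H x"
proof -
  have ne: "{q\<in>\<rat>. x < q} \<noteq> {}" for x :: real
    using Rats_dense_in_real[of x "x + 1"] by auto
  have bdd: "bdd_below (F ` Q)" for Q
    using F(1) by (intro bdd_belowI[of _ 0]) auto
  have mono: "H x \<le> H y" if "x \<le> y" for x y
    unfolding H_def by (rule cINF_superset_mono) (use ne bdd that in auto)
  have top: "H x = 1" if "b \<le> x" for x
    unfolding H_def using that ne F(4)
    by (subst INF_cong[OF refl, of _ _ "\<lambda>_. 1"]) auto
  have H0: "0 \<le> H x" for x
    unfolding H_def by (rule cINF_greatest) (use ne F in auto)
  have bot: "H x = 0" if "x < a" for x
  proof -
    from Rats_dense_in_real[OF that] obtain q where "q \<in> \<rat>" "x < q" "q < a" by auto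
    then have "H x \<le> F q" unfolding H_def by (intro cINF_lower bdd) auto
    with F(3)[OF \<open>q < a\<close>] H0[of x] show ?thesis by simp
  qed
  have cont: "continuous (at_right x) H" for x
    unfolding continuous_within
  proof (rule order_tendstoI)
    fix c assume "c < H x"
    then show "\<forall>\<^sub>F y in at_right x. c < H y"
      using mono
      by (intro eventually_mono[OF eventually_at_right_less[of x]]) (auto intro: less_le_trans)
  next
    fix c assume "H x < c"
    then obtain q where q: "q \<in> \<rat>" "x < q" "F q < c"
      unfolding H_def using ne bdd by (subst (asm) cINF_less_iff) auto
    have "H y < c" if "y < q" for y
    proof -
      have "H y \<le> F q" unfolding H_def using q that by (intro cINF_lower bdd) auto
      with q show ?thesis by simp
    qed
    then show "\<forall>\<^sub>F y in at_right x. H y < c"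
      using q(2) eventually_at_right by blast
  qed
  have lim0: "(H \<longlongrightarrow> 0) at_bot"
    using eventually_at_bot_dense bot by (intro tendsto_eventually) blast
  have lim1: "(H \<longlongrightarrow> 1) at_top"
    using eventually_at_top_linorder top by (intro tendsto_eventually) blast
  show "real_distribution (interval_measure H)"
    by (rule real_distribution_interval_measure) (use mono cont lim0 lim1 in auto)
  show "measure (interval_measure H) {..x} = H x"
    by (rule measure_interval_measure_Iic) (use mono cont lim0 in auto)
qed

section \<open>Conditional distributions as integral identities\<close>

lemma (in prob_space) regular_cond_distr_integral:
  fixes u :: "'a \<Rightarrow> real"
  assumes \<kappa>: "regular_cond_distr M L Y N Z \<kappa>"
    and Y: "Y \<in> M \<rightarrow>\<^sub>M L" and Z: "Z \<in> M \<rightarrow>\<^sub>M N" and B: "B \<in> sets L"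
    and u: "u \<in> borel_measurable (vimage_algebra (space M) Z N)"
    and c: "\<And>\<omega>. \<omega> \<in> space M \<Longrightarrow> \<bar>u \<omega>\<bar> \<le> c"
  shows "(\<integral>\<omega>. u \<omega> * measure (\<kappa> (Z \<omega>)) B \<partial>M) = (\<integral>\<omega>. u \<omega> * indicator B (Y \<omega>) \<partial>M)"
proof -
  interpret S: sigma_finite_subalgebra M "vimage_algebra (space M) Z N"
    by (rule subalgebra_vimage(2)[OF Z])
  note uM[measurable] = measurable_from_subalg[OF S.subalg u]
  note [measurable] = Y Z B
  have [measurable]: "\<kappa> \<in> N \<rightarrow>\<^sub>M prob_algebra L"
    using \<kappa> by (simp add: regular_cond_distr_def)
  have [measurable]: "(\<lambda>z. measure (\<kappa> z) B) \<in> borel_measurable N" by measurable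
  have "(\<integral>\<omega>. u \<omega> * measure (\<kappa> (Z \<omega>)) B \<partial>M)
      = (\<integral>\<omega>. u \<omega> * real_cond_exp M (vimage_algebra (space M) Z N) (indicator (Y -` B \<inter> space M)) \<omega> \<partial>M)"
    using \<kappa> B by (intro integral_cong_AE) (auto simp: regular_cond_distr_def)
  also have "\<dots> = (\<integral>\<omega>. u \<omega> * indicator (Y -` B \<inter> space M) \<omega> \<partial>M)"
    by (intro S.real_cond_exp_intg(2) u integrable_boundedI[of _ c])
      (auto simp: indicator_def intro: c order_trans[OF abs_ge_zero c])
  also have "\<dots> = (\<integral>\<omega>. u \<omega> * indicator B (Y \<omega>) \<partial>M)"
    by (intro Bochner_Integration.integral_cong) (auto simp: indicator_def)
  finally show ?thesis .
qed

text \<open>The sets of the \<sigma>-algebra generated by \<open>Z\<close> are exactly the preimages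
  of sets of \<open>N\<close>, so indicators of \<open>C\<close> at \<open>Z\<close> are enough to
  characterise the conditional expectation. Together with \<open>regular_cond_distr_integral\<close>
  this allows passing freely between the almost-sure definition and integrals.\<close>

lemma (in prob_space) regular_cond_distrI:
  assumes \<kappa>[measurable]: "\<kappa> \<in> N \<rightarrow>\<^sub>M prob_algebra L"
    and Y[measurable]: "Y \<in> M \<rightarrow>\<^sub>M L" and Z[measurable]: "Z \<in> M \<rightarrow>\<^sub>M N"
    and eq: "\<And>B C. B \<in> sets L \<Longrightarrow> C \<in> sets N \<Longrightarrow>
      (\<integral>\<omega>. indicator C (Z \<omega>) * measure (\<kappa> (Z \<omega>)) B \<partial>M)
        = (\<integral>\<omega>. indicator C (Z \<omega>) * indicator B (Y \<omega>) \<partial>M)"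
  shows "regular_cond_distr M L Y N Z \<kappa>"
  unfolding regular_cond_distr_def
proof (intro conjI \<kappa> ballI)
  fix B assume B[measurable]: "B \<in> sets L"
  interpret S: sigma_finite_subalgebra M "vimage_algebra (space M) Z N"
    by (rule subalgebra_vimage(2)[OF Z])
  have [measurable]: "(\<lambda>z. measure (\<kappa> z) B) \<in> borel_measurable N" by measurable
  have bd: "measure (\<kappa> (Z \<omega>)) B \<le> 1" if "\<omega> \<in> space M" for \<omega>
    using measurable_space[OF \<kappa> measurable_space[OF Z that]]
    by (auto simp: space_prob_algebra intro: prob_space.prob_le_1)
  have "AE \<omega> in M. real_cond_exp M (vimage_algebra (space M) Z N) (indicator (Y -` B \<inter> space M)) \<omega>
      = measure (\<kappa> (Z \<omega>)) B"
  proof (rule S.real_cond_exp_charact)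
    fix D assume "D \<in> sets (vimage_algebra (space M) Z N)"
    then obtain C where C: "C \<in> sets N" "D = Z -` C \<inter> space M"
      using measurable_space[OF Z] by (auto simp: sets_vimage_algebra2)
    have "(\<integral>\<omega>\<in>D. indicator (Y -` B \<inter> space M) \<omega> \<partial>M) = (\<integral>\<omega>. indicator C (Z \<omega>) * indicator B (Y \<omega>) \<partial>M :: real)"
      unfolding set_lebesgue_integral_def C
      by (intro Bochner_Integration.integral_cong) (auto simp: indicator_def)
    also have "\<dots> = (\<integral>\<omega>\<in>D. measure (\<kappa> (Z \<omega>)) B \<partial>M)"
      unfolding eq[OF B C(1), symmetric] set_lebesgue_integral_def C
      by (intro Bochner_Integration.integral_cong) (auto simp: indicator_def)
    finally show "(\<integral>\<omega>\<in>D. indicator (Y -` B \<inter> space M) \<omega> \<partial>M) = (\<integral>\<omega>\<in>D. measure (\<kappa> (Z \<omega>)) B \<partial>M)" .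
  next
    show "integrable M (indicator (Y -` B \<inter> space M) :: 'a \<Rightarrow> real)"
      by (rule integrable_boundedI[of _ 1]) (auto simp: indicator_def)
    show "integrable M (\<lambda>\<omega>. measure (\<kappa> (Z \<omega>)) B)"
      by (rule integrable_boundedI[of _ 1]) (auto simp: bd)
    have "Z \<in> vimage_algebra (space M) Z N \<rightarrow>\<^sub>M N"
      using measurable_space[OF Z] by (intro measurable_vimage_algebra1) auto
    then show "(\<lambda>\<omega>. measure (\<kappa> (Z \<omega>)) B) \<in> borel_measurable (vimage_algebra (space M) Z N)"
      by measurable
  qed
  then show "AE \<omega> in M. measure (\<kappa> (Z \<omega>)) B =
      real_cond_exp M (vimage_algebra (space M) Z N) (indicator (Y -` B \<inter> space M)) \<omega>"
    by eventually_elim simp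
qed

text \<open>The kernel's distribution function is an infimum, but dominated convergence needs a
  limit along a sequence. Monotonicity is demanded at rationals only, because conditional
  distribution functions are almost surely monotone just for countably many arguments at
  once.\<close>

lemma INF_rat_tendsto:
  fixes F :: "real \<Rightarrow> real"
  assumes mono: "\<And>p q. p \<in> \<rat> \<Longrightarrow> q \<in> \<rat> \<Longrightarrow> p \<le> q \<Longrightarrow> F p \<le> F q"
    and bdd: "bdd_below (range F)"
    and r: "\<And>n. r n \<in> \<rat>" "\<And>n. x < r n" "r \<longlonglongrightarrow> x"
  shows "(\<lambda>n. F (r n)) \<longlonglongrightarrow> (INF q\<in>{q\<in>\<rat>. x < q}. F q)"
proof (rule order_tendstoI)
  have bdd': "bdd_below (F ` Q)" for Q
    using bdd by (rule bdd_below_mono) auto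
  fix c assume c: "c < (INF q\<in>{q\<in>\<rat>. x < q}. F q)"
  have "c < F (r n)" for n
    using r by (intro less_le_trans[OF c] cINF_lower bdd') auto
  then show "\<forall>\<^sub>F n in sequentially. c < F (r n)" by simp
next
  have bdd': "bdd_below (F ` Q)" for Q
    using bdd by (rule bdd_below_mono) auto
  fix c assume "(INF q\<in>{q\<in>\<rat>. x < q}. F q) < c"
  moreover have "{q\<in>\<rat>. x < q} \<noteq> {}"
    using r by auto
  ultimately obtain q where q: "q \<in> \<rat>" "x < q" "F q < c"
    using bdd' by (subst (asm) cINF_less_iff) auto
  from order_tendstoD(2)[OF r(3) q(2)] show "\<forall>\<^sub>F n in sequentially. F (r n) < c"
    by eventually_elim (use q r mono in \<open>auto intro: le_less_trans[of _ "F q"]\<close>)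
qed

text \<open>For fixed \<open>C\<close> both sides are finite Borel measures in the set that replaces
  \<open>{..x}\<close>: the law of \<open>Y\<close> on the event that \<open>Z\<close> lies in
  \<open>C\<close>, and the mixture of the kernels over that event. Finite Borel measures on the
  line with the same distribution function coincide.\<close>

lemma (in prob_space) regular_cond_distrI_atMost:
  fixes Y :: "'a \<Rightarrow> real"
  assumes \<kappa>[measurable]: "\<kappa> \<in> N \<rightarrow>\<^sub>M prob_algebra borel"
    and Y[measurable]: "Y \<in> borel_measurable M" and Z[measurable]: "Z \<in> M \<rightarrow>\<^sub>M N"
    and eq: "\<And>x C. C \<in> sets N \<Longrightarrow>
      (\<integral>\<omega>. indicator C (Z \<omega>) * measure (\<kappa> (Z \<omega>)) {..x} \<partial>M)
        = (\<integral>\<omega>. indicator C (Z \<omega>) * indicator {..x} (Y \<omega>) \<partial>M)"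
  shows "regular_cond_distr M borel Y N Z \<kappa>"
proof (rule regular_cond_distrI[OF \<kappa> Y Z])
  fix B :: "real set" and C assume B: "B \<in> sets borel" and C[measurable]: "C \<in> sets N"
  define M' where "M' = density M (\<lambda>\<omega>. indicator C (Z \<omega>))"
  have [measurable_cong]: "sets M' = sets M" by (simp add: M'_def)
  have [simp]: "space M' = space M" by (simp add: M'_def)
  have \<kappa>': "(\<lambda>\<omega>. \<kappa> (Z \<omega>)) \<in> M' \<rightarrow>\<^sub>M subprob_algebra borel"
    by (intro measurable_prob_algebraD) measurable
  have p: "prob_space (\<kappa> (Z \<omega>))" if "\<omega> \<in> space M" for \<omega>
    using measurable_space[OF \<kappa> measurable_space[OF Z that]] by (auto simp: space_prob_algebra)
  have 1: "emeasure (distr M' borel Y) D = ennreal (\<integral>\<omega>. indicator C (Z \<omega>) * indicator D (Y \<omega>) \<partial>M)"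
    if [measurable]: "D \<in> sets borel" for D
  proof -
    have "emeasure (distr M' borel Y) D = (\<integral>\<^sup>+\<omega>. indicator D (Y \<omega>) \<partial>M')"
      by (subst nn_integral_indicator[symmetric], simp, subst nn_integral_distr) auto
    also have "\<dots> = (\<integral>\<^sup>+\<omega>. ennreal (indicator C (Z \<omega>) * indicator D (Y \<omega>)) \<partial>M)"
      unfolding M'_def by (subst nn_integral_density) (auto intro!: nn_integral_cong simp: indicator_def)
    also have "\<dots> = ennreal (\<integral>\<omega>. indicator C (Z \<omega>) * indicator D (Y \<omega>) \<partial>M)"
      by (intro nn_integral_eq_integral integrable_boundedI[of _ 1]) (auto simp: indicator_def)
    finally show ?thesis .
  qed
  have 2: "emeasure (M' \<bind> (\<lambda>\<omega>. \<kappa> (Z \<omega>))) D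
      = ennreal (\<integral>\<omega>. indicator C (Z \<omega>) * measure (\<kappa> (Z \<omega>)) D \<partial>M)"
    if D[measurable]: "D \<in> sets borel" for D
  proof -
    have [measurable]: "(\<lambda>z. measure (\<kappa> z) D) \<in> borel_measurable N" by measurable
    have "emeasure (M' \<bind> (\<lambda>\<omega>. \<kappa> (Z \<omega>))) D = (\<integral>\<^sup>+\<omega>. emeasure (\<kappa> (Z \<omega>)) D \<partial>M')"
      by (rule emeasure_bind[OF _ \<kappa>' D]) (simp add: not_empty)
    also have "\<dots> = (\<integral>\<^sup>+\<omega>. ennreal (measure (\<kappa> (Z \<omega>)) D) \<partial>M')"
      by (intro nn_integral_cong finite_measure.emeasure_eq_measure prob_space.finite_measure p) simp
    also have "\<dots> = (\<integral>\<^sup>+\<omega>. ennreal (indicator C (Z \<omega>) * measure (\<kappa> (Z \<omega>)) D) \<partial>M)"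
      unfolding M'_def by (subst nn_integral_density) (auto intro!: nn_integral_cong simp: indicator_def)
    also have "\<dots> = ennreal (\<integral>\<omega>. indicator C (Z \<omega>) * measure (\<kappa> (Z \<omega>)) D \<partial>M)"
      by (intro nn_integral_eq_integral integrable_boundedI[of _ 1])
        (auto simp: indicator_def prob_space.prob_le_1[OF p])
    finally show ?thesis .
  qed
  have s2: "sets (M' \<bind> (\<lambda>\<omega>. \<kappa> (Z \<omega>))) = sets borel"
    by (rule sets_bind[OF sets_kernel[OF \<kappa>']]) (auto simp: not_empty)
  have "distr M' borel Y = M' \<bind> (\<lambda>\<omega>. \<kappa> (Z \<omega>))"
  proof (rule cdf_unique')
    show "finite_borel_measure (distr M' borel Y)"
      unfolding finite_borel_measure_def finite_borel_measure_axioms_def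
      by (auto intro!: finite_measureI simp del: emeasure_distr simp: 1)
    show "finite_borel_measure (M' \<bind> (\<lambda>\<omega>. \<kappa> (Z \<omega>)))"
      unfolding finite_borel_measure_def finite_borel_measure_axioms_def
      using s2 sets_eq_imp_space_eq[OF s2]
      by (auto intro!: finite_measureI simp: 2)
    show "cdf (distr M' borel Y) = cdf (M' \<bind> (\<lambda>\<omega>. \<kappa> (Z \<omega>)))"
      unfolding cdf_def measure_def by (intro ext) (simp del: emeasure_distr add: 1 2 eq)
  qed
  with 1[OF B] 2[OF B] show "(\<integral>\<omega>. indicator C (Z \<omega>) * measure (\<kappa> (Z \<omega>)) B \<partial>M)
      = (\<integral>\<omega>. indicator C (Z \<omega>) * indicator B (Y \<omega>) \<partial>M)"
    by (simp add: ennreal_inj integral_nonneg_AE)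
qed

text \<open>
  Working on the law \<open>J\<close> of \<open>(Z, Y)\<close> makes a function measurable in \<open>Z\<close> literally a function of the
  first coordinate, evaluated at a fixed second coordinate; this replaces the Doob--Dynkin lemma.
\<close>

lemma (in prob_space) regular_cond_distr_exists_bounded:
  fixes Y :: "'a \<Rightarrow> real"
  assumes Y[measurable]: "Y \<in> borel_measurable M" and Z[measurable]: "Z \<in> M \<rightarrow>\<^sub>M N"
    and b: "\<And>\<omega>. \<omega> \<in> space M \<Longrightarrow> \<bar>Y \<omega>\<bar> \<le> b"
  shows "\<exists>\<kappa>. regular_cond_distr M borel Y N Z \<kappa>"
proof -
  have "0 \<le> b"
    using not_empty b by (auto intro: order_trans[OF abs_ge_zero])
  define J where "J = distr M (N \<Otimes>\<^sub>M borel) (\<lambda>\<omega>. (Z \<omega>, Y \<omega>))"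
  interpret J: prob_space J unfolding J_def by (rule prob_space_distr) simp
  have sJ[measurable_cong]: "sets J = sets (N \<Otimes>\<^sub>M borel)" by (simp add: J_def)
  have spJ: "space J = space N \<times> space (borel :: real measure)"
    by (simp add: J_def space_pair_measure)
  define G where "G = vimage_algebra (space J) fst N"
  have fst[measurable]: "fst \<in> J \<rightarrow>\<^sub>M N" by (simp add: measurable_cong_sets[OF sJ refl])
  interpret S: sigma_finite_subalgebra J G
    unfolding G_def by (rule J.subalgebra_vimage(2)) measurable
  define E where "E q = space N \<times> {..q}" for q :: real
  have [measurable]: "E q \<in> sets J" for q by (auto simp: E_def sJ)
  define c where "c q = real_cond_exp J G (indicator (E q))" for q
  have cG: "c q \<in> vimage_algebra (space N \<times> space (borel :: real measure)) fst N \<rightarrow>\<^sub>M borel" for q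
    unfolding c_def G_def spJ by simp
  have [measurable]: "(\<lambda>z. c q (z, 0)) \<in> borel_measurable N" for q
    by (rule vimage_algebra_fst_factor(1)[OF cG]) simp
  have c_fact: "c q j = c q (fst j, 0)" if "j \<in> space J" for q j
    using vimage_algebra_fst_factor(2)[OF cG, of 0 "fst j" "snd j"] that by (simp add: spJ mem_Times_iff)
  have int: "integrable J (indicator (E q) :: _ \<Rightarrow> real)" for q
    by (rule J.integrable_boundedI[of _ 1]) auto
  \<comment> \<open>Clipping and the prescribed values outside \<open>[-b, b)\<close> make every
    \<open>F z\<close> satisfy the hypotheses of \<open>interval_measure_INF_rat\<close>. By
    \<open>F_eq\<close> they alter \<open>c q\<close> only on a null set, because a conditional
    expectation of an indicator lies in [0, 1] almost surely and \<open>Y\<close> stays within the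
    bound \<open>b\<close>.\<close>
  define F where "F z q = (if q < - b then 0 else if b \<le> q then 1 else max 0 (min 1 (c q (z, 0))))" for z q
  have F: "0 \<le> F z q" "F z q \<le> 1" "q < - b \<Longrightarrow> F z q = 0" "b \<le> q \<Longrightarrow> F z q = 1" for z q
    using \<open>0 \<le> b\<close> by (auto simp: F_def)
  have [measurable]: "(\<lambda>z. F z q) \<in> borel_measurable N" for q
    unfolding F_def by measurable
  have AE_bd: "AE j in J. \<bar>snd j\<bar> \<le> b"
    unfolding J_def by (subst AE_distr_iff) (auto simp: b)
  have F_eq: "AE j in J. F (fst j) q = c q j" for q
  proof -
    have 0: "AE j in J. c q j = 0" if "q < - b"
    proof -
      have "AE j in J. indicator (E q) j = (0::real)"
        using AE_bd by eventually_elim (use that in \<open>auto simp: E_def indicator_def\<close>)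
      from S.real_cond_exp_cong[OF this] have "AE j in J. c q j = real_cond_exp J G (\<lambda>_. 0) j"
        unfolding c_def by simp
      moreover have "AE j in J. real_cond_exp J G (\<lambda>_. 0) j = 0"
        by (rule S.real_cond_exp_F_meas) auto
      ultimately show ?thesis by eventually_elim simp
    qed
    have 1: "AE j in J. c q j = 1" if "b \<le> q"
    proof -
      have "AE j in J. indicator (E q) j = (1::real)"
        using AE_bd AE_space by eventually_elim (use that in \<open>auto simp: E_def indicator_def spJ\<close>)
      from S.real_cond_exp_cong[OF this] have "AE j in J. c q j = real_cond_exp J G (\<lambda>_. 1) j"
        unfolding c_def by simp
      moreover have "AE j in J. real_cond_exp J G (\<lambda>_. 1) j = 1"
        by (rule S.real_cond_exp_F_meas) auto
      ultimately show ?thesis by eventually_elim simp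
    qed
    have 2: "AE j in J. 0 \<le> c q j" "AE j in J. c q j \<le> 1"
      unfolding c_def by (rule S.real_cond_exp_ge_c S.real_cond_exp_le_c, rule int, simp add: indicator_def)+
    have 3: "AE j in J. c q j = c q (fst j, 0)"
      using c_fact by (rule AE_I2)
    show ?thesis
    proof (cases "q < - b \<or> b \<le> q")
      case True
      then show ?thesis using 0 1 F(3,4) by (elim disjE) (auto simp: F_def)
    next
      case False
      show ?thesis using 2 3 by eventually_elim (use False in \<open>simp add: F_def\<close>)
    qed
  qed
  have c_mono: "AE j in J. c p j \<le> c q j" if "p \<le> q" for p q
    unfolding c_def using that int
    by (intro S.real_cond_exp_mono) (auto simp: E_def indicator_def)
  have "AE j in J. \<forall>p\<in>\<rat>. \<forall>q\<in>\<rat>. p \<le> q \<longrightarrow> F (fst j) p \<le> F (fst j) q"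
  proof (intro AE_ball_countable[THEN iffD2] ballI countable_rat)
    fix p q :: real
    show "AE j in J. p \<le> q \<longrightarrow> F (fst j) p \<le> F (fst j) q"
    proof (cases "p \<le> q")
      case True
      show ?thesis using F_eq[of p] F_eq[of q] c_mono[OF True] by eventually_elim simp
    qed simp
  qed
  then have F_mono: "AE \<omega> in M. \<forall>p\<in>\<rat>. \<forall>q\<in>\<rat>. p \<le> q \<longrightarrow> F (Z \<omega>) p \<le> F (Z \<omega>) q"
    unfolding J_def by (auto dest!: AE_distrD[rotated])
  have F_int: "(\<integral>\<omega>. indicator C (Z \<omega>) * F (Z \<omega>) q \<partial>M) = (\<integral>\<omega>. indicator C (Z \<omega>) * indicator {..q} (Y \<omega>) \<partial>M)"
    if [measurable]: "C \<in> sets N" for C q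
  proof -
    have fG: "fst \<in> G \<rightarrow>\<^sub>M N" unfolding G_def by (rule measurable_vimage_algebra1) (auto simp: spJ)
    have "(\<integral>\<omega>. indicator C (Z \<omega>) * F (Z \<omega>) q \<partial>M) = (\<integral>j. indicator C (fst j) * F (fst j) q \<partial>J)"
      unfolding J_def by (subst integral_distr) auto
    also have "\<dots> = (\<integral>j. indicator C (fst j) * c q j \<partial>J)"
      by (rule integral_cong_AE) (use F_eq[of q] in \<open>auto simp: c_def\<close>)
    also have "\<dots> = (\<integral>j. indicator C (fst j) * indicator (E q) j \<partial>J)"
      unfolding c_def
      by (intro S.real_cond_exp_intg(2) J.integrable_boundedI[of _ 1] measurable_compose[OF fG])
        (auto simp: indicator_def)
    also have "\<dots> = (\<integral>\<omega>. indicator C (Z \<omega>) * indicator {..q} (Y \<omega>) \<partial>M)"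
      unfolding J_def using measurable_space[OF Z]
      by (subst integral_distr) (auto intro!: Bochner_Integration.integral_cong simp: E_def indicator_def)
    finally show ?thesis .
  qed
  define H where "H z x = (INF q\<in>{q\<in>\<rat>. x < q}. F z q)" for z x
  have H_rd: "real_distribution (interval_measure (H z))"
    and H_eq: "measure (interval_measure (H z)) {..x} = H z x" for z x
    using interval_measure_INF_rat[of "F z" "- b" b, OF F] unfolding H_def by auto
  have bdd: "bdd_below (F z ` Q)" for z Q
    using F(1) by (intro bdd_belowI[of _ 0]) auto
  have [measurable]: "(\<lambda>z. H z x) \<in> borel_measurable N" for x
    unfolding H_def
    by (intro borel_measurable_cINF countable_subset[OF _ countable_rat] bdd) auto
  have \<kappa>: "(\<lambda>z. interval_measure (H z)) \<in> N \<rightarrow>\<^sub>M prob_algebra borel"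
  proof (rule measurable_prob_algebra_generated)
    show "sets (borel :: real measure) = sigma_sets UNIV (range atMost)"
      by (subst borel_eq_atMost) simp
    show "Int_stable (range (atMost :: real \<Rightarrow> _))"
      by (auto simp: Int_stable_def)
    show "(\<lambda>z. emeasure (interval_measure (H z)) A) \<in> borel_measurable N" if "A \<in> range atMost" for A
    proof -
      have "emeasure (interval_measure (H z)) {..x} = ennreal (H z x)" for z x
        using H_rd[of z] unfolding real_distribution_def
        by (simp add: finite_measure.emeasure_eq_measure prob_space.finite_measure H_eq)
      with that show ?thesis by auto
    qed
  qed (use H_rd in \<open>auto simp: real_distribution_def\<close>)
  have "regular_cond_distr M borel Y N Z (\<lambda>z. interval_measure (H z))"
  proof (rule regular_cond_distrI_atMost[OF \<kappa> Y Z])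
    fix x C assume C[measurable]: "C \<in> sets N"
    \<comment> \<open>\<open>F_int\<close> concerns \<open>F\<close>, whereas the kernel has
      \<open>H\<close>. Along rationals strictly above \<open>x\<close> both sides converge:
      \<open>F\<close> tends to \<open>H\<close> at \<open>x\<close>, and the half-lines shrink to
      \<open>{..x}\<close> with its endpoint.\<close>
    have "\<exists>r. \<forall>n. r n \<in> \<rat> \<and> x < r n \<and> r n < x + 1 / real (Suc n)"
    proof (intro choice allI)
      fix n
      have "x < x + 1 / real (Suc n)" by simp
      from Rats_dense_in_real[OF this]
      show "\<exists>q. q \<in> \<rat> \<and> x < q \<and> q < x + 1 / real (Suc n)" by blast
    qed
    then obtain r where r: "\<And>n. r n \<in> \<rat>" "\<And>n. x < r n" "\<And>n. r n < x + 1 / real (Suc n)"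
      by blast
    have "(\<lambda>n. x + 1 / real (Suc n)) \<longlonglongrightarrow> x + 0"
      by (intro tendsto_intros LIMSEQ_Suc[OF lim_1_over_n])
    then have rx: "r \<longlonglongrightarrow> x"
      by (intro tendsto_sandwich[OF _ _ tendsto_const[of x], of r])
        (use r in \<open>auto intro!: always_eventually less_imp_le\<close>)
    have L1: "(\<lambda>n. \<integral>\<omega>. indicator C (Z \<omega>) * F (Z \<omega>) (r n) \<partial>M) \<longlonglongrightarrow> (\<integral>\<omega>. indicator C (Z \<omega>) * H (Z \<omega>) x \<partial>M)"
    proof (rule integral_dominated_convergence[where w="\<lambda>_. 1"])
      show "AE \<omega> in M. (\<lambda>n. indicator C (Z \<omega>) * F (Z \<omega>) (r n)) \<longlonglongrightarrow> indicator C (Z \<omega>) * H (Z \<omega>) x"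
        using F_mono
      proof eventually_elim
        case (elim \<omega>)
        then show ?case unfolding H_def
          by (intro tendsto_mult tendsto_const INF_rat_tendsto r rx bdd) auto
      qed
    qed (use F in \<open>auto simp: indicator_def\<close>)
    have L2: "(\<lambda>n. \<integral>\<omega>. indicator C (Z \<omega>) * (indicator {..r n} (Y \<omega>) :: real) \<partial>M)
        \<longlonglongrightarrow> (\<integral>\<omega>. indicator C (Z \<omega>) * indicator {..x} (Y \<omega>) \<partial>M)"
    proof (rule integral_dominated_convergence[where w="\<lambda>_. 1"])
      have "(\<lambda>n. indicator {..r n} y :: real) \<longlonglongrightarrow> indicator {..x} y" for y
      proof (rule tendsto_eventually, cases "y \<le> x")
        case True
        then show "\<forall>\<^sub>F n in sequentially. (indicator {..r n} y :: real) = indicator {..x} y"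
          using order_trans[OF _ less_imp_le[OF r(2)]] by (auto simp: indicator_def)
      next
        case False
        then have "\<forall>\<^sub>F n in sequentially. r n < y" using rx by (intro order_tendstoD) auto
        then show "\<forall>\<^sub>F n in sequentially. (indicator {..r n} y :: real) = indicator {..x} y"
          by eventually_elim (use False in \<open>auto simp: indicator_def\<close>)
      qed
      then show "AE \<omega> in M. (\<lambda>n. indicator C (Z \<omega>) * indicator {..r n} (Y \<omega>) :: real)
          \<longlonglongrightarrow> indicator C (Z \<omega>) * indicator {..x} (Y \<omega>)"
        by (intro AE_I2 tendsto_mult tendsto_const) auto
    qed (auto simp: indicator_def)
    show "(\<integral>\<omega>. indicator C (Z \<omega>) * measure (interval_measure (H (Z \<omega>))) {..x} \<partial>M)
        = (\<integral>\<omega>. indicator C (Z \<omega>) * indicator {..x} (Y \<omega>) \<partial>M)"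
      unfolding H_eq using L1 unfolding F_int[OF C] by (rule LIMSEQ_unique[OF _ L2])
  qed
  then show ?thesis by blast
qed

text \<open>The bounded case is applied to \<open>arctan\<close> of \<open>Y\<close>, and its kernel
  is pushed forward by \<open>tan\<close>. As a total function \<open>tan\<close> is Borel and
  undoes \<open>arctan\<close>, so every push-forward is a probability measure on the line, even
  where a kernel charges points outside (-pi/2, pi/2).\<close>

theorem (in prob_space) regular_cond_distr_exists:
  fixes Y :: "'a \<Rightarrow> real"
  assumes Y[measurable]: "Y \<in> borel_measurable M" and Z[measurable]: "Z \<in> M \<rightarrow>\<^sub>M N"
  shows "\<exists>\<kappa>. regular_cond_distr M borel Y N Z \<kappa>"
proof -
  have "\<bar>arctan y\<bar> \<le> pi / 2" for y
    using arctan_bounded[of y] by auto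
  then obtain \<kappa> where \<kappa>: "regular_cond_distr M borel (\<lambda>\<omega>. arctan (Y \<omega>)) N Z \<kappa>"
    using regular_cond_distr_exists_bounded[of "\<lambda>\<omega>. arctan (Y \<omega>)" Z N "pi / 2"] by auto
  have [measurable]: "tan \<in> borel_measurable (borel :: real measure)"
    unfolding tan_def[abs_def] by measurable
  have k[measurable]: "\<kappa> \<in> N \<rightarrow>\<^sub>M prob_algebra borel"
    using \<kappa> by (simp add: regular_cond_distr_def)
  have "(\<lambda>z. distr (\<kappa> z) borel tan) \<in> N \<rightarrow>\<^sub>M prob_algebra borel"
    by (rule measurable_compose[OF k measurable_distr_prob_space]) simp
  moreover have "AE \<omega> in M. measure (distr (\<kappa> (Z \<omega>)) borel tan) B =
      real_cond_exp M (vimage_algebra (space M) Z N) (indicator (Y -` B \<inter> space M)) \<omega>"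
    if [measurable]: "B \<in> sets borel" for B
  proof -
    have "tan -` B \<in> sets (borel :: real measure)"
      using measurable_sets[of tan borel borel B] by simp
    then have "AE \<omega> in M. measure (\<kappa> (Z \<omega>)) (tan -` B) = real_cond_exp M (vimage_algebra (space M) Z N)
        (indicator ((\<lambda>\<omega>. arctan (Y \<omega>)) -` (tan -` B) \<inter> space M)) \<omega>"
      using \<kappa> by (auto simp: regular_cond_distr_def)
    moreover have "(\<lambda>\<omega>. arctan (Y \<omega>)) -` (tan -` B) = Y -` B"
      by (auto simp: tan_arctan)
    moreover have "measure (distr (\<kappa> (Z \<omega>)) borel tan) B = measure (\<kappa> (Z \<omega>)) (tan -` B)" if "\<omega> \<in> space M" for \<omega>
    proof -
      have s: "sets (\<kappa> (Z \<omega>)) = sets borel"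
        using measurable_space[OF k measurable_space[OF Z that]] by (simp add: space_prob_algebra)
      show ?thesis
        by (subst measure_distr) (use sets_eq_imp_space_eq[OF s] in \<open>auto simp: measurable_cong_sets[OF s refl]\<close>)
    qed
    ultimately show ?thesis by (auto elim!: AE_mp)
  qed
  ultimately show ?thesis unfolding regular_cond_distr_def by blast
qed

section \<open>Weighted laws of pairs\<close>

text \<open>Nonnegative bounded weights are densities, so each side is a finite image measure on the
  product. Rectangles are closed under intersection and include the whole space, hence they
  determine it. Rectangle identities are what both the exogeneity hypothesis and the moment
  restrictions deliver directly.\<close>

lemma distr_density_eq_of_rectangles:
  fixes M :: "'a measure" and w w' :: "'a \<Rightarrow> real"
  assumes M: "prob_space M"
    and [measurable]: "Z \<in> M \<rightarrow>\<^sub>M N" "Y \<in> M \<rightarrow>\<^sub>M L" "Y' \<in> M \<rightarrow>\<^sub>M L"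
      "w \<in> borel_measurable M" "w' \<in> borel_measurable M"
    and w: "\<And>\<omega>. \<omega> \<in> space M \<Longrightarrow> 0 \<le> w \<omega>" "\<And>\<omega>. \<omega> \<in> space M \<Longrightarrow> w \<omega> \<le> c"
    and w': "\<And>\<omega>. \<omega> \<in> space M \<Longrightarrow> 0 \<le> w' \<omega>" "\<And>\<omega>. \<omega> \<in> space M \<Longrightarrow> w' \<omega> \<le> c"
    and eq: "\<And>C B. C \<in> sets N \<Longrightarrow> B \<in> sets L \<Longrightarrow>
      (\<integral>\<omega>. w \<omega> * (indicator C (Z \<omega>) * indicator B (Y \<omega>)) \<partial>M)
        = (\<integral>\<omega>. w' \<omega> * (indicator C (Z \<omega>) * indicator B (Y' \<omega>)) \<partial>M)"
  shows "distr (density M (\<lambda>\<omega>. ennreal (w \<omega>))) (N \<Otimes>\<^sub>M L) (\<lambda>\<omega>. (Z \<omega>, Y \<omega>))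
      = distr (density M (\<lambda>\<omega>. ennreal (w' \<omega>))) (N \<Otimes>\<^sub>M L) (\<lambda>\<omega>. (Z \<omega>, Y' \<omega>))"
    (is "?D w Y = ?D w' Y'")
proof -
  interpret prob_space M by fact
  have em: "emeasure (?D v U) (C \<times> B) = ennreal (\<integral>\<omega>. v \<omega> * (indicator C (Z \<omega>) * indicator B (U \<omega>)) \<partial>M)"
    if [measurable]: "U \<in> M \<rightarrow>\<^sub>M L" "v \<in> borel_measurable M" "C \<in> sets N" "B \<in> sets L"
      and v: "\<And>\<omega>. \<omega> \<in> space M \<Longrightarrow> 0 \<le> v \<omega>" "\<And>\<omega>. \<omega> \<in> space M \<Longrightarrow> v \<omega> \<le> c" for U v C B
  proof -
    have "0 \<le> c" using not_empty v by (auto intro: order_trans)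
    have "emeasure (?D v U) (C \<times> B) = (\<integral>\<^sup>+\<omega>. indicator (C \<times> B) (Z \<omega>, U \<omega>) \<partial>density M (\<lambda>\<omega>. ennreal (v \<omega>)))"
      by (subst nn_integral_indicator[symmetric], simp, subst nn_integral_distr) auto
    also have "\<dots> = (\<integral>\<^sup>+\<omega>. ennreal (v \<omega> * (indicator C (Z \<omega>) * indicator B (U \<omega>))) \<partial>M)"
      by (subst nn_integral_density) (auto intro!: nn_integral_cong simp: indicator_def)
    also have "\<dots> = ennreal (\<integral>\<omega>. v \<omega> * (indicator C (Z \<omega>) * indicator B (U \<omega>)) \<partial>M)"
      using v \<open>0 \<le> c\<close>
      by (intro nn_integral_eq_integral integrable_boundedI[of _ c]) (auto simp: indicator_def)
    finally show ?thesis .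
  qed
  show ?thesis
  proof (rule measure_eqI_generator_eq)
    show "Int_stable {a \<times> b |a b. a \<in> sets N \<and> b \<in> sets L}"
      by (rule Int_stable_pair_measure_generator)
    show "{a \<times> b |a b. a \<in> sets N \<and> b \<in> sets L} \<subseteq> Pow (space N \<times> space L)"
      by (rule pair_measure_closed)
    show "sets (?D w Y) = sigma_sets (space N \<times> space L) {a \<times> b |a b. a \<in> sets N \<and> b \<in> sets L}"
      "sets (?D w' Y') = sigma_sets (space N \<times> space L) {a \<times> b |a b. a \<in> sets N \<and> b \<in> sets L}"
      by (simp_all add: sets_pair_measure)
    show "range (\<lambda>_::nat. space N \<times> space L) \<subseteq> {a \<times> b |a b. a \<in> sets N \<and> b \<in> sets L}"
      by auto
    show "(\<Union>i::nat. space N \<times> space L) = space N \<times> space L" by simp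
    show "emeasure (?D w Y) (space N \<times> space L) \<noteq> \<infinity>" for i :: nat
      by (subst em) (use w in auto)
    fix E assume "E \<in> {a \<times> b |a b. a \<in> sets N \<and> b \<in> sets L}"
    then obtain C B where "C \<in> sets N" "B \<in> sets L" "E = C \<times> B" by auto
    then show "emeasure (?D w Y) E = emeasure (?D w' Y') E"
      using w w' by (simp del: emeasure_distr add: em eq)
  qed
qed

text \<open>Both sides are integrals of \<open>g\<close> against one and the same image measure.
  Hence \<open>g\<close> may mix its two arguments, as the shift from \<open>V\<close> to
  \<open>A - V\<close> does, and the identity holds whether or not \<open>g\<close> is
  integrable.\<close>

lemma integral_weighted_eq_of_rectangles:
  fixes M :: "'a measure" and w w' :: "'a \<Rightarrow> real" and g :: "'b \<times> 'c \<Rightarrow> real"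
  assumes M: "prob_space M"
    and [measurable]: "Z \<in> M \<rightarrow>\<^sub>M N" "Y \<in> M \<rightarrow>\<^sub>M L" "Y' \<in> M \<rightarrow>\<^sub>M L"
      "w \<in> borel_measurable M" "w' \<in> borel_measurable M"
    and w: "\<And>\<omega>. \<omega> \<in> space M \<Longrightarrow> 0 \<le> w \<omega>" "\<And>\<omega>. \<omega> \<in> space M \<Longrightarrow> w \<omega> \<le> c"
    and w': "\<And>\<omega>. \<omega> \<in> space M \<Longrightarrow> 0 \<le> w' \<omega>" "\<And>\<omega>. \<omega> \<in> space M \<Longrightarrow> w' \<omega> \<le> c"
    and eq: "\<And>C B. C \<in> sets N \<Longrightarrow> B \<in> sets L \<Longrightarrow>
      (\<integral>\<omega>. w \<omega> * (indicator C (Z \<omega>) * indicator B (Y \<omega>)) \<partial>M)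
        = (\<integral>\<omega>. w' \<omega> * (indicator C (Z \<omega>) * indicator B (Y' \<omega>)) \<partial>M)"
    and g[measurable]: "g \<in> borel_measurable (N \<Otimes>\<^sub>M L)"
  shows "(\<integral>\<omega>. w \<omega> * g (Z \<omega>, Y \<omega>) \<partial>M) = (\<integral>\<omega>. w' \<omega> * g (Z \<omega>, Y' \<omega>) \<partial>M)"
proof -
  have rep: "(\<integral>\<omega>. v \<omega> * g (Z \<omega>, U \<omega>) \<partial>M)
      = (\<integral>p. g p \<partial>distr (density M (\<lambda>\<omega>. ennreal (v \<omega>))) (N \<Otimes>\<^sub>M L) (\<lambda>\<omega>. (Z \<omega>, U \<omega>)))"
    if [measurable]: "U \<in> M \<rightarrow>\<^sub>M L" "v \<in> borel_measurable M"
      and v: "\<And>\<omega>. \<omega> \<in> space M \<Longrightarrow> 0 \<le> v \<omega>" for U v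
  proof -
    have "AE \<omega> in M. 0 \<le> v \<omega>" using v by (rule AE_I2)
    moreover have "(\<lambda>\<omega>. g (Z \<omega>, U \<omega>)) \<in> borel_measurable M" by measurable
    ultimately have "(\<integral>\<omega>. v \<omega> * g (Z \<omega>, U \<omega>) \<partial>M) = (\<integral>\<omega>. g (Z \<omega>, U \<omega>) \<partial>density M (\<lambda>\<omega>. ennreal (v \<omega>)))"
      using that(2) by (simp add: integral_density)
    also have "\<dots> = (\<integral>p. g p \<partial>distr (density M (\<lambda>\<omega>. ennreal (v \<omega>))) (N \<Otimes>\<^sub>M L) (\<lambda>\<omega>. (Z \<omega>, U \<omega>)))"
      by (subst integral_distr[where f=g and g="\<lambda>\<omega>. (Z \<omega>, U \<omega>)"]) simp_all
    finally show ?thesis .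
  qed
  have "(\<integral>\<omega>. w \<omega> * g (Z \<omega>, Y \<omega>) \<partial>M)
      = (\<integral>p. g p \<partial>distr (density M (\<lambda>\<omega>. ennreal (w \<omega>))) (N \<Otimes>\<^sub>M L) (\<lambda>\<omega>. (Z \<omega>, Y \<omega>)))"
    by (rule rep) (fact assms w)+
  also have "\<dots> = (\<integral>p. g p \<partial>distr (density M (\<lambda>\<omega>. ennreal (w' \<omega>))) (N \<Otimes>\<^sub>M L) (\<lambda>\<omega>. (Z \<omega>, Y' \<omega>)))"
    by (rule arg_cong[where f="\<lambda>D. integral\<^sup>L D g"], rule distr_density_eq_of_rectangles[OF assms(1-6) w w' eq])
  also have "\<dots> = (\<integral>\<omega>. w' \<omega> * g (Z \<omega>, Y' \<omega>) \<partial>M)"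
    by (rule rep[symmetric]) (fact assms w')+
  finally show ?thesis .
qed

section \<open>Encoding the simplex by real numbers\<close>

text \<open>
  With digits 0 and 1 in base 4 the tail of the expansion stays below one unit of the previous
  digit, so expansions are unambiguous and digits can be read off with the floor function.
\<close>

lemma base4_digit:
  fixes b :: "nat \<Rightarrow> bool"
  shows "odd \<lfloor>4 ^ n * (\<Sum>k. of_bool (b k) * (1/4::real) ^ k)\<rfloor> \<longleftrightarrow> b n"
proof -
  define f where "f k = of_bool (b k) * (1/4::real) ^ k" for k
  have f: "0 \<le> f k" "f k \<le> (1/4) ^ k" for k by (auto simp: f_def)
  have sf: "summable f"
    by (rule summable_comparison_test'[OF summable_geometric[of "1/4::real"], of 0]) (use f in auto)
  \<comment> \<open>Scaling by \<open>4 ^ n\<close> turns the digits before the \<open>n\<close>-th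
    into even integers, the \<open>n\<close>-th into a unit, and the later ones into
    \<open>t\<close>, which is at most 1/3 since the geometric series of 1/4 sums to 4/3. So the
    floor has the parity of digit \<open>n\<close>.\<close>
  define m where "m = (\<Sum>k<n. of_bool (b k) * (4::int) ^ (n - k))"
  define t where "t = 4 ^ n * (\<Sum>k. f (k + Suc n))"
  have "even m" unfolding m_def by (intro dvd_sum) auto
  have "f (k + Suc n) \<le> (1/4) ^ Suc n * (1/4) ^ k" for k
    using f(2)[of "k + Suc n"] by (simp add: power_add mult_ac)
  then have "(\<Sum>k. f (k + Suc n)) \<le> (\<Sum>k. (1/4) ^ Suc n * (1/4) ^ k)"
    by (intro suminf_le summable_mult summable_geometric summable_ignore_initial_segment sf) auto
  also have "\<dots> = (1/4) ^ Suc n * (4/3)"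
    by (subst suminf_mult) (auto simp: suminf_geometric summable_geometric)
  finally have "t \<le> 4 ^ n * ((1/4) ^ Suc n * (4/3))"
    unfolding t_def by (intro mult_left_mono) auto
  also have "\<dots> = 1 / 3" by (simp add: power_one_over)
  finally have t1: "t < 1" by simp
  have t0: "0 \<le> t"
    unfolding t_def by (intro mult_nonneg_nonneg suminf_nonneg summable_ignore_initial_segment sf f) simp
  have "4 ^ n * f k = of_bool (b k) * 4 ^ (n - k)" if "k \<le> n" for k
    using that by (simp add: f_def power_diff power_one_over)
  then have "4 ^ n * (\<Sum>k<Suc n. f k) = (\<Sum>k<Suc n. of_bool (b k) * 4 ^ (n - k))"
    unfolding sum_distrib_left by (intro sum.cong) auto
  also have "\<dots> = of_int (m + of_bool (b n))"
    by (simp add: m_def)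
  finally have "4 ^ n * (\<Sum>k. f k) = of_int (m + of_bool (b n)) + t"
    by (subst suminf_split_initial_segment[OF sf, of "Suc n"]) (simp only: t_def distrib_left)
  then have "\<lfloor>4 ^ n * (\<Sum>k. f k)\<rfloor> = m + of_bool (b n)"
    using t0 t1 by (intro floor_unique) auto
  with \<open>even m\<close> show ?thesis unfolding f_def by simp
qed

text \<open>Digit \<open>n\<close> of \<open>a s\<close> records membership in \<open>B n\<close>,
  and \<open>D n\<close> reads that digit. Each \<open>B n\<close> thus becomes the preimage of a
  Borel set, that is, an event of the \<sigma>-algebra generated by \<open>a\<close>.\<close>

lemma countable_family_real_encoding:
  fixes B :: "nat \<Rightarrow> 'a set"
  assumes B[measurable]: "\<And>n. B n \<in> sets S"
  obtains a :: "'a \<Rightarrow> real" and D :: "nat \<Rightarrow> real set"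
  where "a \<in> borel_measurable S" "\<And>n. D n \<in> sets borel" "\<And>n s. a s \<in> D n \<longleftrightarrow> s \<in> B n"
proof
  define a where "a s = (\<Sum>k. of_bool (s \<in> B k) * (1/4::real) ^ k)" for s
  have "(\<lambda>s. of_bool (s \<in> B k) :: real) = indicator (B k)" for k
    by (auto simp: indicator_def)
  then have [measurable]: "(\<lambda>s. of_bool (s \<in> B k) :: real) \<in> borel_measurable S" for k
    by simp
  show "a \<in> borel_measurable S"
    unfolding a_def by measurable
  show "{r. odd \<lfloor>4 ^ n * r :: real\<rfloor>} \<in> sets borel" for n
  proof -
    have "(\<lambda>r :: real. \<lfloor>4 ^ n * r\<rfloor>) \<in> borel \<rightarrow>\<^sub>M count_space UNIV" by measurable
    from measurable_sets[OF this, of "{i. odd i}"] show ?thesis by (simp add: vimage_def)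
  qed
  show "a s \<in> {r. odd \<lfloor>4 ^ n * r\<rfloor>} \<longleftrightarrow> s \<in> B n" for n s
    using base4_digit[of n "\<lambda>k. s \<in> B k"] by (simp add: a_def)
qed

section \<open>Bounds and measurability on the simplex\<close>

lemma prob_simplex_le_1:
  assumes "finite \<X>" "\<nu> \<in> prob_simplex \<X>" "x \<in> \<X>"
  shows "0 \<le> \<nu> x" "\<nu> x \<le> 1"
proof -
  have nn: "\<And>y. y \<in> \<X> \<Longrightarrow> 0 \<le> \<nu> y"
    using assms(2) by (auto simp: prob_simplex_def PiE_iff)
  then show "0 \<le> \<nu> x" using assms(3) .
  have "\<nu> x \<le> (\<Sum>y\<in>\<X>. \<nu> y)"
    using assms nn by (intro member_le_sum) auto
  then show "\<nu> x \<le> 1" using assms(2) by (simp add: prob_simplex_def)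
qed

lemma history_prob_bounds:
  assumes "finite \<X>" "\<nu> \<in> prob_simplex \<X>"
  shows "0 \<le> history_prob \<X> \<nu> t h" "history_prob \<X> \<nu> t h \<le> 1"
proof -
  show "0 \<le> history_prob \<X> \<nu> t h"
    unfolding history_prob_def using prob_simplex_le_1[OF assms] by (intro sum_nonneg) auto
  have "history_prob \<X> \<nu> t h \<le> (\<Sum>y\<in>\<X>. \<nu> y)"
    unfolding history_prob_def using prob_simplex_le_1[OF assms] assms(1) by (intro sum_mono2) auto
  then show "history_prob \<X> \<nu> t h \<le> 1" using assms(2) by (simp add: prob_simplex_def)
qed

lemma space_simplex_space: "space (simplex_space \<X>) = prob_simplex \<X>"
  by (auto simp: simplex_space_def space_restrict_space space_PiM prob_simplex_def PiE_iff extensional_def)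

lemma measurable_simplex_component[measurable]:
  "x \<in> \<X> \<Longrightarrow> (\<lambda>\<nu>. \<nu> x) \<in> borel_measurable (simplex_space \<X>)"
  unfolding simplex_space_def by (intro measurable_restrict_space1) measurable

lemma measurable_history_prob[measurable]:
  "(\<lambda>\<nu>. history_prob \<X> \<nu> t h) \<in> borel_measurable (simplex_space \<X>)"
  unfolding history_prob_def by (intro borel_measurable_sum) auto

lemma measurable_into_simplex_space:
  assumes "\<And>x. x \<in> \<X> \<Longrightarrow> (\<lambda>\<omega>. \<nu> \<omega> x) \<in> borel_measurable G"
    and "\<And>\<omega>. \<omega> \<in> space G \<Longrightarrow> \<nu> \<omega> \<in> prob_simplex \<X>"
  shows "\<nu> \<in> G \<rightarrow>\<^sub>M simplex_space \<X>"
  unfolding simplex_space_def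
proof (rule measurable_restrict_space2)
  show "\<nu> \<in> space G \<rightarrow> prob_simplex \<X>" using assms(2) by auto
  have "(\<lambda>\<omega> x. \<nu> \<omega> x) \<in> G \<rightarrow>\<^sub>M (\<Pi>\<^sub>M x\<in>\<X>. borel)"
    using assms by (intro measurable_PiM_single') (auto simp: prob_simplex_def PiE_iff space_PiM)
  then show "\<nu> \<in> G \<rightarrow>\<^sub>M (\<Pi>\<^sub>M x\<in>\<X>. borel)" by simp
qed

text \<open>The encoded events are \<open>\<nu> x < q\<close> for \<open>x\<close> in
  \<open>\<X>\<close> and rational \<open>q\<close>, which make every coordinate measurable.
  Measurability of the identity out of the \<sigma>-algebra of \<open>a\<close> says that \<nu> can
  be recovered measurably from \<open>a \<nu>\<close>, without naming a decoding map.\<close>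

lemma simplex_space_real_encoding:
  assumes "finite \<X>" "\<X> \<noteq> {}"
  obtains a :: "('p \<Rightarrow> real) \<Rightarrow> real"
  where "a \<in> borel_measurable (simplex_space \<X>)"
    and "(\<lambda>\<nu>. \<nu>) \<in> vimage_algebra (prob_simplex \<X>) a borel \<rightarrow>\<^sub>M simplex_space \<X>"
proof -
  define I where "I = \<X> \<times> (\<rat> :: real set)"
  have I: "countable I" "I \<noteq> {}"
    unfolding I_def using assms countable_finite[OF assms(1)] countable_rat Rats_0 by auto
  define B where "B = (\<lambda>(x, q). {\<nu> \<in> space (simplex_space \<X>). \<nu> x < q})"
  have "B i \<in> sets (simplex_space \<X>)" if "i \<in> I" for i
    using that by (auto simp: I_def B_def)
  then have "B (from_nat_into I n) \<in> sets (simplex_space \<X>)" for n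
    using from_nat_into[OF I(2)] by blast
  then obtain a D where a: "a \<in> borel_measurable (simplex_space \<X>)"
    and D: "\<And>n. D n \<in> sets (borel :: real measure)" "\<And>n s. a s \<in> D n \<longleftrightarrow> s \<in> B (from_nat_into I n)"
    using countable_family_real_encoding[of "\<lambda>n. B (from_nat_into I n)"] by metis
  let ?G = "vimage_algebra (prob_simplex \<X>) a borel"
  have BG: "B i \<in> sets ?G" if "i \<in> I" for i
  proof -
    from from_nat_into_surj[OF I(1) that] obtain n where "i = from_nat_into I n"
      by metis
    then have "B i = a -` D n \<inter> prob_simplex \<X>"
      using D(2)[of _ n] by (auto simp: B_def space_simplex_space)
    then show ?thesis using in_vimage_algebra[OF D(1)] by simp
  qed
  have "(\<lambda>\<nu>. \<nu>) \<in> ?G \<rightarrow>\<^sub>M simplex_space \<X>"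
  proof (rule measurable_into_simplex_space)
    fix x assume x: "x \<in> \<X>"
    show "(\<lambda>\<nu>. \<nu> x) \<in> borel_measurable ?G"
    proof (rule borel_measurableI_less)
      fix y :: real
      have "{\<nu> \<in> space ?G. \<nu> x < y} = (\<Union>q\<in>{q\<in>\<rat>. q < y}. B (x, q))"
      proof (intro set_eqI iffI)
        fix \<nu> assume "\<nu> \<in> {\<nu> \<in> space ?G. \<nu> x < y}"
        moreover then obtain q where "q \<in> \<rat>" "\<nu> x < q" "q < y"
          using Rats_dense_in_real[of "\<nu> x" y] by auto
        ultimately show "\<nu> \<in> (\<Union>q\<in>{q\<in>\<rat>. q < y}. B (x, q))"
          by (auto simp: B_def space_simplex_space)
      qed (auto simp: B_def space_simplex_space)
      also have "\<dots> \<in> sets ?G"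
        using BG x by (intro sets.countable_UN' countable_subset[OF _ countable_rat]) (auto simp: I_def)
      finally show "{\<nu> \<in> space ?G. \<nu> x < y} \<in> sets ?G" .
    qed
  qed simp
  with a that show thesis by blast
qed

section \<open>Conditional path probabilities\<close>

lemma history_1_eq_iff: "history 1 x = history 1 y \<longleftrightarrow> x 1 = y 1"
  by (auto simp: history_def restrict_def fun_eq_iff)

text \<open>The conditional expectations given \<open>A\<close> live on the sample space, so the
  restrictions are moved there from the law. The change of variables requires integrands that are
  measurable on \<open>law_space\<close>, which the facts \<open>1\<close> and \<open>2\<close>
  supply.\<close>

lemma distr_mem_Gamma_laws_iff:
  fixes M :: "'a measure" and \<X> :: "(nat \<Rightarrow> 'c) set"
  assumes M: "prob_space M"
    and X[measurable]: "X \<in> M \<rightarrow>\<^sub>M count_space \<X>"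
    and V[measurable]: "V \<in> M \<rightarrow>\<^sub>M (\<Pi>\<^sub>M t\<in>{1..T}. borel)"
    and \<nu>[measurable]: "\<nu> \<in> M \<rightarrow>\<^sub>M simplex_space \<X>"
  shows "distr M (law_space T \<X>) (\<lambda>\<omega>. (X \<omega>, V \<omega>, \<nu> \<omega>)) \<in> Gamma_laws T \<X> \<longleftrightarrow>
    (\<forall>r \<in> borel_measurable (simplex_space \<X>). bounded (r ` prob_simplex \<X>) \<longrightarrow>
       (\<forall>x\<in>\<X>. (\<integral>\<omega>. r (\<nu> \<omega>) * (of_bool (X \<omega> = x) - \<nu> \<omega> x) \<partial>M) = 0) \<and>
       (\<forall>f \<in> borel_measurable borel. bounded (range f) \<longrightarrow>
         (\<forall>x\<in>\<X>. \<forall>t\<in>{2..T}.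
           (\<integral>\<omega>. r (\<nu> \<omega>) *
               (f (V \<omega> t) * of_bool (history t (X \<omega>) = history t x) * history_prob \<X> (\<nu> \<omega>) 1 (history 1 x)
                - f (V \<omega> 1) * of_bool (X \<omega> 1 = x 1) * history_prob \<X> (\<nu> \<omega>) t (history t x)) \<partial>M)
             = (0::real))))"
proof -
  have m: "(\<lambda>\<omega>. (X \<omega>, V \<omega>, \<nu> \<omega>)) \<in> M \<rightarrow>\<^sub>M law_space T \<X>"
    unfolding law_space_def by measurable
  have p: "prob_space (distr M (law_space T \<X>) (\<lambda>\<omega>. (X \<omega>, V \<omega>, \<nu> \<omega>)))"
    by (rule prob_space.prob_space_distr[OF M m])
  let ?L = "law_space T \<X>"
  have ob: "(\<lambda>w. of_bool (P (fst w)) :: real) \<in> borel_measurable ?L" for P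
    unfolding law_space_def by (rule measurable_compose[OF measurable_fst]) simp
  have n: "(\<lambda>w. snd (snd w)) \<in> ?L \<rightarrow>\<^sub>M simplex_space \<X>"
    unfolding law_space_def by measurable
  have v: "(\<lambda>w. fst (snd w) t) \<in> borel_measurable ?L" if "t \<in> {1..T}" for t
    using that unfolding law_space_def by measurable
  have 1: "(\<lambda>w. r (snd (snd w)) * (of_bool (fst w = x) - snd (snd w) x)) \<in> borel_measurable ?L"
    if "r \<in> borel_measurable (simplex_space \<X>)" "x \<in> \<X>" for r x
    using ob[of "\<lambda>y. y = x"] measurable_compose[OF n that(1)]
      measurable_compose[OF n measurable_simplex_component[OF that(2)]]
    by (intro borel_measurable_times borel_measurable_diff)
  have 2: "(\<lambda>w. r (snd (snd w)) *
               (f (fst (snd w) t) * of_bool (history t (fst w) = history t x) * history_prob \<X> (snd (snd w)) 1 (history 1 x)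
                - f (fst (snd w) 1) * of_bool (fst w 1 = x 1) * history_prob \<X> (snd (snd w)) t (history t x)))
            \<in> borel_measurable ?L"
    if r: "r \<in> borel_measurable (simplex_space \<X>)" and f: "f \<in> borel_measurable borel" and t: "t \<in> {2..T}"
    for r f x t
  proof -
    from t have "t \<in> {1..T}" "1 \<in> {1..T}" by auto
    with ob[of "\<lambda>y. history t y = history t x"] ob[of "\<lambda>y. y 1 = x 1"]
      measurable_compose[OF n r] measurable_compose[OF n measurable_history_prob]
      v[THEN measurable_compose[OF _ f]]
    show ?thesis
      by (intro borel_measurable_times borel_measurable_diff)
  qed
  show ?thesis
    unfolding Gamma_laws_def mem_Collect_eq split_beta'
    by (simp only: p sets_distr simp_thms integral_distr[OF m 1] integral_distr[OF m 2] fst_conv snd_conv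
        cong: ball_cong)
qed

text \<open>Since \<open>A\<close> factors through \<open>Z\<close>, its \<sigma>-algebra is
  contained in that of \<open>Z\<close>. The application is \<open>q = fst\<close>, where
  conditioning on \<open>A\<close> is refined by a covariate.\<close>

lemma measurable_vimage_algebra_coarser:
  assumes A: "A \<in> \<Omega> \<rightarrow> space N" and Z: "Z \<in> \<Omega> \<rightarrow> space N'"
    and q: "q \<in> N' \<rightarrow>\<^sub>M N" "\<And>\<omega>. \<omega> \<in> \<Omega> \<Longrightarrow> q (Z \<omega>) = A \<omega>"
    and U: "U \<in> vimage_algebra \<Omega> A N \<rightarrow>\<^sub>M L"
  shows "U \<in> vimage_algebra \<Omega> Z N' \<rightarrow>\<^sub>M L"
proof -
  have "(\<lambda>\<omega>. q (Z \<omega>)) \<in> vimage_algebra \<Omega> Z N' \<rightarrow>\<^sub>M N"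
    by (rule measurable_compose[OF measurable_vimage_algebra1[OF Z] q(1)])
  then have "A \<in> vimage_algebra \<Omega> Z N' \<rightarrow>\<^sub>M N"
    by (subst measurable_cong[where g="\<lambda>\<omega>. q (Z \<omega>)"]) (simp_all add: q)
  then have "(\<lambda>\<omega>. \<omega>) \<in> vimage_algebra \<Omega> Z N' \<rightarrow>\<^sub>M vimage_algebra \<Omega> A N"
    by (intro measurable_vimage_algebra2) auto
  from measurable_compose[OF this U] show ?thesis .
qed

lemma abs_mult_le_of_le_1:
  fixes u v :: real
  assumes "\<bar>u\<bar> \<le> c" "\<bar>v\<bar> \<le> 1"
  shows "\<bar>u * v\<bar> \<le> c"
  using mult_mono[OF assms] assms(1) by (simp add: abs_mult)

text \<open>Measurability of \<open>\<nu>\<close> in \<open>A\<close> is demanded outright and not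
  just up to a null set, so that \<open>r (\<nu> \<omega>)\<close> and \<open>history_prob\<close>
  are themselves measurable in \<open>A\<close> and can serve as test factors. One direction obtains
  this from a version of \<nu>, the other from the encoding.\<close>

locale path_process = prob_space M
  for M :: "'a measure" and \<X> :: "(nat \<Rightarrow> 'c) set" and X :: "'a \<Rightarrow> nat \<Rightarrow> 'c"
    and A :: "'a \<Rightarrow> real" and \<nu> :: "'a \<Rightarrow> (nat \<Rightarrow> 'c) \<Rightarrow> real" +
  assumes finite_paths: "finite \<X>"
    and X: "X \<in> M \<rightarrow>\<^sub>M count_space \<X>"
    and A: "A \<in> borel_measurable M"
    and \<nu>: "\<nu> \<in> vimage_algebra (space M) A borel \<rightarrow>\<^sub>M simplex_space \<X>"
    and cond_prob: "is_cond_prob_path \<X> M X A \<nu>"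
begin

abbreviation "\<G> \<equiv> vimage_algebra (space M) A borel"
abbreviation "history_space t \<equiv> borel \<Otimes>\<^sub>M count_space (history t ` \<X>)"
abbreviation "initial_space \<equiv> borel \<Otimes>\<^sub>M count_space ((\<lambda>x. x 1) ` \<X>)"

sublocale G: sigma_finite_subalgebra M \<G>
  by (rule subalgebra_vimage(2)[OF A])

section \<open>Integrals of path events against functions of \<open>A\<close>\<close>

lemma of_bool_path_measurable: "(\<lambda>\<omega>. of_bool (P (X \<omega>)) :: real) \<in> borel_measurable M"
  by (rule measurable_compose[OF X]) simp

lemma X_in: "\<omega> \<in> space M \<Longrightarrow> X \<omega> \<in> \<X>"
  using measurable_space[OF X] by simp

lemma \<nu>_in: "\<omega> \<in> space M \<Longrightarrow> \<nu> \<omega> \<in> prob_simplex \<X>"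
  using measurable_space[OF \<nu>] by (simp add: space_simplex_space)

lemma \<nu>_measurable: "\<nu> \<in> M \<rightarrow>\<^sub>M simplex_space \<X>"
  by (rule measurable_from_subalg[OF G.subalg \<nu>])

lemma A_measurable_G: "A \<in> borel_measurable \<G>"
  by (rule measurable_vimage_algebra1) simp

lemma history_prob_measurable_G: "(\<lambda>\<omega>. history_prob \<X> (\<nu> \<omega>) t h) \<in> borel_measurable \<G>"
  by (rule measurable_compose[OF \<nu> measurable_history_prob])

lemma history_prob_01:
  assumes "\<omega> \<in> space M"
  shows "0 \<le> history_prob \<X> (\<nu> \<omega>) t h" "history_prob \<X> (\<nu> \<omega>) t h \<le> 1"
  using history_prob_bounds[OF finite_paths \<nu>_in[OF assms]] by auto

lemma history_measurable: "(\<lambda>\<omega>. (A \<omega>, history t (X \<omega>))) \<in> M \<rightarrow>\<^sub>M history_space t"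
  using measurable_compose[OF X, of "history t" "count_space (history t ` \<X>)"] A by auto

lemma initial_measurable: "(\<lambda>\<omega>. (A \<omega>, X \<omega> 1)) \<in> M \<rightarrow>\<^sub>M initial_space"
  using measurable_compose[OF X, of "\<lambda>x. x 1" "count_space ((\<lambda>x. x 1) ` \<X>)"] A by auto

lemma measurable_G_finer:
  assumes "U \<in> borel_measurable \<G>" "(\<lambda>\<omega>. (A \<omega>, W \<omega>)) \<in> M \<rightarrow>\<^sub>M borel \<Otimes>\<^sub>M N"
  shows "U \<in> borel_measurable (vimage_algebra (space M) (\<lambda>\<omega>. (A \<omega>, W \<omega>)) (borel \<Otimes>\<^sub>M N))"
  using measurable_space[OF assms(2)]
  by (intro measurable_vimage_algebra_coarser[OF _ _ _ _ assms(1), where q=fst]) auto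

lemma integral_path_eq:
  assumes U: "U \<in> borel_measurable \<G>" and c: "\<And>\<omega>. \<omega> \<in> space M \<Longrightarrow> \<bar>U \<omega> :: real\<bar> \<le> c" and x: "x \<in> \<X>"
  shows "(\<integral>\<omega>. U \<omega> * of_bool (X \<omega> = x) \<partial>M) = (\<integral>\<omega>. U \<omega> * \<nu> \<omega> x \<partial>M)"
proof -
  note m = measurable_from_subalg[OF G.subalg U]
    measurable_compose[OF \<nu>_measurable measurable_simplex_component[OF x]]
  have i: "indicator {\<omega> \<in> space M. X \<omega> = x} \<omega> = (of_bool (X \<omega> = x) :: real)" if "\<omega> \<in> space M" for \<omega>
    using that by simp
  have "X -` {x} \<inter> space M \<in> sets M"
    using x by (intro measurable_sets[OF X]) simp
  also have "X -` {x} \<inter> space M = {\<omega> \<in> space M. X \<omega> = x}" by auto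
  finally have S: "{\<omega> \<in> space M. X \<omega> = x} \<in> sets M" .
  have "(\<integral>\<omega>. U \<omega> * of_bool (X \<omega> = x) \<partial>M) = (\<integral>\<omega>. U \<omega> * indicator {\<omega> \<in> space M. X \<omega> = x} \<omega> \<partial>M)"
    using i by (intro Bochner_Integration.integral_cong) auto
  also have "\<dots> = (\<integral>\<omega>. U \<omega> * real_cond_exp M \<G> (indicator {\<omega> \<in> space M. X \<omega> = x}) \<omega> \<partial>M)"
  proof (rule G.real_cond_exp_intg(2)[symmetric, OF _ U])
    show "integrable M (\<lambda>\<omega>. U \<omega> * indicator {\<omega> \<in> space M. X \<omega> = x} \<omega>)"
      by (intro integrable_boundedI[of _ c] borel_measurable_times m borel_measurable_indicator S
          abs_mult_le_of_le_1 c) (auto split: split_indicator)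
  qed (intro borel_measurable_indicator S)
  also have "\<dots> = (\<integral>\<omega>. U \<omega> * \<nu> \<omega> x \<partial>M)"
    using cond_prob x
    by (intro integral_cong_AE borel_measurable_times m borel_measurable_cond_exp2)
      (auto simp: is_cond_prob_path_def)
  finally show ?thesis .
qed

text \<open>The event of having history \<open>h\<close> is the disjoint union of the events
  \<open>X \<omega> = x\<close> over the finitely many paths with that history, so
  \<open>integral_path_eq\<close> is summed over them.\<close>

lemma integral_history_eq:
  assumes U: "U \<in> borel_measurable \<G>" and c: "\<And>\<omega>. \<omega> \<in> space M \<Longrightarrow> \<bar>U \<omega> :: real\<bar> \<le> c"
  shows "(\<integral>\<omega>. U \<omega> * of_bool (history t (X \<omega>) = h) \<partial>M) = (\<integral>\<omega>. U \<omega> * history_prob \<X> (\<nu> \<omega>) t h \<partial>M)"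
proof -
  note UM = measurable_from_subalg[OF G.subalg U]
  let ?S = "{x \<in> \<X>. history t x = h}"
  have "of_bool (history t (X \<omega>) = h) = (\<Sum>x\<in>?S. of_bool (X \<omega> = x) :: real)" if "\<omega> \<in> space M" for \<omega>
    using X_in[OF that] finite_paths by (auto simp: of_bool_def sum.delta' sum.delta)
  then have "(\<integral>\<omega>. U \<omega> * of_bool (history t (X \<omega>) = h) \<partial>M) = (\<integral>\<omega>. (\<Sum>x\<in>?S. U \<omega> * of_bool (X \<omega> = x)) \<partial>M)"
    by (intro Bochner_Integration.integral_cong) (auto simp: sum_distrib_left)
  also have "\<dots> = (\<Sum>x\<in>?S. \<integral>\<omega>. U \<omega> * of_bool (X \<omega> = x) \<partial>M)"
    by (intro Bochner_Integration.integral_sum integrable_boundedI[of _ c] borel_measurable_times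
        UM of_bool_path_measurable abs_mult_le_of_le_1 c) simp_all
  also have "\<dots> = (\<Sum>x\<in>?S. \<integral>\<omega>. U \<omega> * \<nu> \<omega> x \<partial>M)"
    by (intro sum.cong integral_path_eq[OF U c]) auto
  also have "\<dots> = (\<integral>\<omega>. (\<Sum>x\<in>?S. U \<omega> * \<nu> \<omega> x) \<partial>M)"
  proof (intro Bochner_Integration.integral_sum[symmetric] integrable_boundedI[of _ c])
    fix x assume x: "x \<in> ?S"
    then show "(\<lambda>\<omega>. U \<omega> * \<nu> \<omega> x) \<in> borel_measurable M"
      by (intro borel_measurable_times UM measurable_compose[OF \<nu>_measurable measurable_simplex_component]) simp
    fix \<omega> assume "\<omega> \<in> space M"
    then show "\<bar>U \<omega> * \<nu> \<omega> x\<bar> \<le> c"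
      using prob_simplex_le_1[OF finite_paths \<nu>_in, of \<omega> x] x
      by (intro abs_mult_le_of_le_1 c) auto
  qed
  also have "\<dots> = (\<integral>\<omega>. U \<omega> * history_prob \<X> (\<nu> \<omega>) t h \<partial>M)"
    by (simp add: history_prob_def sum_distrib_left)
  finally show ?thesis .
qed

text \<open>With the covariate frozen at \<open>k\<close> the kernel depends on \<open>A\<close>
  only. It can then be part of the factor \<open>U\<close> in \<open>integral_history_eq\<close>,
  which the kernel at the random covariate in general cannot.\<close>

lemma kernel_measurable_G:
  assumes \<kappa>: "\<kappa> \<in> borel \<Otimes>\<^sub>M count_space K \<rightarrow>\<^sub>M prob_algebra borel" and "k \<in> K" and B: "B \<in> sets borel"
  shows "(\<lambda>\<omega>. measure (\<kappa> (A \<omega>, k)) B) \<in> borel_measurable \<G>"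
    and "\<bar>measure (\<kappa> (r, k)) B\<bar> \<le> 1"
proof -
  have "(\<lambda>\<omega>. (A \<omega>, k)) \<in> \<G> \<rightarrow>\<^sub>M borel \<Otimes>\<^sub>M count_space K"
    using \<open>k \<in> K\<close> by (intro measurable_Pair A_measurable_G measurable_const) simp
  from measurable_compose[OF measurable_compose[OF this \<kappa>] measurable_measure_prob_algebra[OF B]]
  show "(\<lambda>\<omega>. measure (\<kappa> (A \<omega>, k)) B) \<in> borel_measurable \<G>" .
  have "prob_space (\<kappa> (r, k))"
    using measurable_space[OF \<kappa>, of "(r, k)"] \<open>k \<in> K\<close> by (auto simp: space_pair_measure space_prob_algebra)
  then show "\<bar>measure (\<kappa> (r, k)) B\<bar> \<le> 1"
    by (simp add: prob_space.prob_le_1)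
qed

text \<open>
  Conditionally on \<open>A\<close>, the events \<open>X\<^sub>1 = x\<^sub>1\<close> and \<open>X\<^sup>t = x\<^sup>t\<close> have probabilities \<open>\<nu>\<^sub>1\<close> and \<open>\<nu>\<^sub>t\<close>,
  which are functions of \<open>A\<close>; so each event can be traded for its probability, and conversely.
\<close>

lemma integral_initial_exchange:
  assumes \<kappa>: "regular_cond_distr M borel Y initial_space (\<lambda>\<omega>. (A \<omega>, X \<omega> 1)) \<kappa>"
    and Y: "Y \<in> borel_measurable M" and x: "x \<in> \<X>" and B: "B \<in> sets borel"
    and U: "U \<in> borel_measurable \<G>" and c: "\<And>\<omega>. \<omega> \<in> space M \<Longrightarrow> \<bar>U \<omega> :: real\<bar> \<le> c"
  shows "(\<integral>\<omega>. U \<omega> * of_bool (X \<omega> 1 = x 1) * history_prob \<X> (\<nu> \<omega>) t (history t x) * indicator B (Y \<omega>) \<partial>M)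
    = (\<integral>\<omega>. U \<omega> * of_bool (history t (X \<omega>) = history t x) * history_prob \<X> (\<nu> \<omega>) 1 (history 1 x)
        * measure (\<kappa> (A \<omega>, x 1)) B \<partial>M)"
proof -
  let ?K = "(\<lambda>x. x 1) ` \<X>"
  have \<kappa>m: "\<kappa> \<in> initial_space \<rightarrow>\<^sub>M prob_algebra borel"
    using \<kappa> by (simp add: regular_cond_distr_def)
  have x1: "x 1 \<in> ?K" using x by auto
  define k where "k \<omega> = measure (\<kappa> (A \<omega>, x 1)) B" for \<omega>
  have k: "k \<in> borel_measurable \<G>" "\<bar>k \<omega>\<bar> \<le> 1" for \<omega>
    unfolding k_def by (rule kernel_measurable_G[OF \<kappa>m x1 B])+
  have nu: "\<bar>history_prob \<X> (\<nu> \<omega>) s h\<bar> \<le> 1" if "\<omega> \<in> space M" for \<omega> s h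
    using history_prob_01[OF that, of s h] by auto
  let ?Z = "\<lambda>\<omega>. (A \<omega>, X \<omega> 1)"
  have ob: "(\<lambda>\<omega>. of_bool (X \<omega> 1 = x 1) :: real) \<in> borel_measurable (vimage_algebra (space M) ?Z initial_space)"
  proof -
    have "?Z \<in> vimage_algebra (space M) ?Z initial_space \<rightarrow>\<^sub>M initial_space"
      using measurable_space[OF initial_measurable] by (intro measurable_vimage_algebra1) auto
    from measurable_compose[OF this measurable_snd]
    have "(\<lambda>\<omega>. X \<omega> 1) \<in> vimage_algebra (space M) ?Z initial_space \<rightarrow>\<^sub>M count_space ?K"
      by simp
    then show ?thesis
      by (rule measurable_compose[where g="\<lambda>y. of_bool (y = x 1)"]) simp
  qed
  have "(\<integral>\<omega>. U \<omega> * of_bool (X \<omega> 1 = x 1) * history_prob \<X> (\<nu> \<omega>) t (history t x) * indicator B (Y \<omega>) \<partial>M)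
      = (\<integral>\<omega>. U \<omega> * of_bool (X \<omega> 1 = x 1) * history_prob \<X> (\<nu> \<omega>) t (history t x) * measure (\<kappa> (A \<omega>, X \<omega> 1)) B \<partial>M)"
  proof (rule regular_cond_distr_integral[OF \<kappa> Y initial_measurable B, symmetric])
    show "(\<lambda>\<omega>. U \<omega> * of_bool (X \<omega> 1 = x 1) * history_prob \<X> (\<nu> \<omega>) t (history t x))
        \<in> borel_measurable (vimage_algebra (space M) ?Z initial_space)"
      by (intro borel_measurable_times ob measurable_G_finer[OF _ initial_measurable] U history_prob_measurable_G)
    show "\<bar>U \<omega> * of_bool (X \<omega> 1 = x 1) * history_prob \<X> (\<nu> \<omega>) t (history t x)\<bar> \<le> c" if "\<omega> \<in> space M" for \<omega>
      by (intro abs_mult_le_of_le_1 c nu that) simp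
  qed
  \<comment> \<open>On the event \<open>X \<omega> 1 = x 1\<close> the kernel equals
    \<open>k\<close>. The event is now the only factor that is not measurable in \<open>A\<close>,
    so it can be traded for \<nu>_1, and afterwards \<nu>_t for the event of the longer
    history.\<close>
  also have "\<dots> = (\<integral>\<omega>. (U \<omega> * history_prob \<X> (\<nu> \<omega>) t (history t x) * k \<omega>) * of_bool (history 1 (X \<omega>) = history 1 x) \<partial>M)"
    by (intro Bochner_Integration.integral_cong) (auto simp: history_1_eq_iff k_def of_bool_def simp del: One_nat_def)
  also have "\<dots> = (\<integral>\<omega>. (U \<omega> * history_prob \<X> (\<nu> \<omega>) t (history t x) * k \<omega>) * history_prob \<X> (\<nu> \<omega>) 1 (history 1 x) \<partial>M)"
    by (rule integral_history_eq[of _ c]) (intro borel_measurable_times abs_mult_le_of_le_1 U k c nu history_prob_measurable_G; assumption)+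
  also have "\<dots> = (\<integral>\<omega>. (U \<omega> * history_prob \<X> (\<nu> \<omega>) 1 (history 1 x) * k \<omega>) * history_prob \<X> (\<nu> \<omega>) t (history t x) \<partial>M)"
    by (simp add: mult_ac)
  also have "\<dots> = (\<integral>\<omega>. (U \<omega> * history_prob \<X> (\<nu> \<omega>) 1 (history 1 x) * k \<omega>) * of_bool (history t (X \<omega>) = history t x) \<partial>M)"
    by (rule integral_history_eq[of _ c, symmetric])
      (intro borel_measurable_times abs_mult_le_of_le_1 U k c nu history_prob_measurable_G; assumption)+
  finally show ?thesis by (simp add: mult_ac k_def)
qed

end

section \<open>Exogeneity as a weighted identity, and back\<close>

lemma history_eq_imp_eq_1:
  assumes "history t x = history t y" "1 \<le> t"
  shows "x 1 = y 1"
  using fun_cong[OF assms(1), of 1] assms(2) by (simp add: history_def)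

context path_process
begin

text \<open>On the event of the history of \<open>x\<close> the shared kernel is evaluated at
  \<open>(A, x 1)\<close>, free of the rest of the history. \<open>integral_initial_exchange\<close>
  then returns from that kernel to the error at time 1 and swaps the two weights.\<close>

lemma sequentially_exogenous_imp_weighted_eq:
  assumes ex: "sequentially_exogenous T \<X> M X V A"
    and V: "\<And>s. s \<in> {1..T} \<Longrightarrow> (\<lambda>\<omega>. V \<omega> s) \<in> borel_measurable M"
    and t: "t \<in> {2..T}" and x: "x \<in> \<X>" and B: "B \<in> sets borel"
    and U: "U \<in> borel_measurable \<G>" and c: "\<And>\<omega>. \<omega> \<in> space M \<Longrightarrow> \<bar>U \<omega> :: real\<bar> \<le> c"
  shows "(\<integral>\<omega>. U \<omega> * of_bool (history t (X \<omega>) = history t x) * history_prob \<X> (\<nu> \<omega>) 1 (history 1 x)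
        * indicator B (V \<omega> t) \<partial>M)
    = (\<integral>\<omega>. U \<omega> * of_bool (X \<omega> 1 = x 1) * history_prob \<X> (\<nu> \<omega>) t (history t x) * indicator B (V \<omega> 1) \<partial>M)"
proof -
  let ?Z = "\<lambda>\<omega>. (A \<omega>, history t (X \<omega>))"
  let ?u = "\<lambda>\<omega>. U \<omega> * of_bool (history t (X \<omega>) = history t x) * history_prob \<X> (\<nu> \<omega>) 1 (history 1 x)"
  obtain \<kappa> \<kappa>' where \<kappa>: "regular_cond_distr M borel (\<lambda>\<omega>. V \<omega> t) (history_space t) ?Z \<kappa>"
    and \<kappa>': "regular_cond_distr M borel (\<lambda>\<omega>. V \<omega> 1) initial_space (\<lambda>\<omega>. (A \<omega>, X \<omega> 1)) \<kappa>'"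
    and eq: "AE \<omega> in M. \<kappa> (A \<omega>, history t (X \<omega>)) = \<kappa>' (A \<omega>, X \<omega> 1)"
    using ex t unfolding sequentially_exogenous_def same_cond_distr_def by blast
  have \<kappa>m: "\<kappa> \<in> history_space t \<rightarrow>\<^sub>M prob_algebra borel" "\<kappa>' \<in> initial_space \<rightarrow>\<^sub>M prob_algebra borel"
    using \<kappa> \<kappa>' by (simp_all add: regular_cond_distr_def)
  from t have t1: "1 \<le> t" and "1 \<in> {1..T}" "t \<in> {1..T}" by auto
  then have V1: "(\<lambda>\<omega>. V \<omega> 1) \<in> borel_measurable M" and Vt: "(\<lambda>\<omega>. V \<omega> t) \<in> borel_measurable M"
    by (blast intro: V)+
  have nu: "\<bar>history_prob \<X> (\<nu> \<omega>) s h\<bar> \<le> 1" if "\<omega> \<in> space M" for \<omega> s h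
    using history_prob_01[OF that, of s h] by auto
  have km: "(\<lambda>\<omega>. measure (\<kappa> (A \<omega>, history t (X \<omega>))) B) \<in> borel_measurable M"
    "(\<lambda>\<omega>. measure (\<kappa>' (A \<omega>, X \<omega> 1)) B) \<in> borel_measurable M"
    by (rule measurable_compose[OF measurable_compose[OF history_measurable \<kappa>m(1)] measurable_measure_prob_algebra[OF B]]
        measurable_compose[OF measurable_compose[OF initial_measurable \<kappa>m(2)] measurable_measure_prob_algebra[OF B]])+
  have u: "?u \<in> borel_measurable (vimage_algebra (space M) ?Z (history_space t))"
  proof -
    have "?Z \<in> vimage_algebra (space M) ?Z (history_space t) \<rightarrow>\<^sub>M history_space t"
      using measurable_space[OF history_measurable] by (intro measurable_vimage_algebra1) auto
    from measurable_compose[OF this measurable_snd]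
    have "(\<lambda>\<omega>. history t (X \<omega>)) \<in> vimage_algebra (space M) ?Z (history_space t) \<rightarrow>\<^sub>M count_space (history t ` \<X>)"
      by simp
    then have ob: "(\<lambda>\<omega>. of_bool (history t (X \<omega>) = history t x) :: real)
        \<in> borel_measurable (vimage_algebra (space M) ?Z (history_space t))"
      by (rule measurable_compose[where g="\<lambda>y. of_bool (y = history t x)"]) simp
    show ?thesis
      by (intro borel_measurable_times ob measurable_G_finer[OF _ history_measurable] U history_prob_measurable_G)
  qed
  have uM: "?u \<in> borel_measurable M"
    by (rule measurable_from_subalg[OF subalgebra_vimage(1)[OF history_measurable] u])
  have "(\<integral>\<omega>. ?u \<omega> * indicator B (V \<omega> t) \<partial>M) = (\<integral>\<omega>. ?u \<omega> * measure (\<kappa> (A \<omega>, history t (X \<omega>))) B \<partial>M)"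
  proof (rule regular_cond_distr_integral[OF \<kappa> Vt history_measurable B u, symmetric])
    show "\<bar>?u \<omega>\<bar> \<le> c" if "\<omega> \<in> space M" for \<omega>
      by (intro abs_mult_le_of_le_1 c nu that) simp
  qed
  also have "\<dots> = (\<integral>\<omega>. ?u \<omega> * measure (\<kappa>' (A \<omega>, X \<omega> 1)) B \<partial>M)"
    using eq by (intro integral_cong_AE borel_measurable_times[OF uM] km) (auto elim!: eventually_mono)
  also have "\<dots> = (\<integral>\<omega>. ?u \<omega> * measure (\<kappa>' (A \<omega>, x 1)) B \<partial>M)"
  proof (rule Bochner_Integration.integral_cong[OF refl])
    \<comment> \<open>Off the history event both sides vanish; on it the paths agree at time 1, as
      \<open>1 \<le> t\<close>.\<close>
    show "?u \<omega> * measure (\<kappa>' (A \<omega>, X \<omega> 1)) B = ?u \<omega> * measure (\<kappa>' (A \<omega>, x 1)) B" for \<omega>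
      using history_eq_imp_eq_1[of t "X \<omega>" x] t1
      by (cases "history t (X \<omega>) = history t x") (simp_all del: One_nat_def)
  qed
  also have "\<dots> = (\<integral>\<omega>. U \<omega> * of_bool (X \<omega> 1 = x 1) * history_prob \<X> (\<nu> \<omega>) t (history t x) * indicator B (V \<omega> 1) \<partial>M)"
    by (rule integral_initial_exchange[OF \<kappa>' V1 x B U c, symmetric])
  finally show ?thesis .
qed

text \<open>The event that X_1 = h while \<nu>_1(h) = 0 has probability
  E[1{\<nu>_1(h) = 0} \<nu>_1(h)] = 0, since \<nu>_1(h) is the conditional probability of X_1 = h.
  Only finitely many \<open>h\<close> occur.\<close>

lemma initial_prob_pos: "AE \<omega> in M. 0 < history_prob \<X> (\<nu> \<omega>) 1 (history 1 (X \<omega>))"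
proof -
  have "AE \<omega> in M. of_bool (history_prob \<X> (\<nu> \<omega>) 1 h = 0) * of_bool (history 1 (X \<omega>) = h) = (0 :: real)" for h
  proof -
    have U: "(\<lambda>\<omega>. of_bool (history_prob \<X> (\<nu> \<omega>) 1 h = 0) :: real) \<in> borel_measurable \<G>"
      by (rule measurable_compose[OF history_prob_measurable_G, where g="\<lambda>q. of_bool (q = 0)"]) simp
    have m: "(\<lambda>\<omega>. of_bool (history_prob \<X> (\<nu> \<omega>) 1 h = 0) * of_bool (history 1 (X \<omega>) = h) :: real) \<in> borel_measurable M"
      by (intro borel_measurable_times measurable_from_subalg[OF G.subalg U] of_bool_path_measurable)
    have "(\<integral>\<omega>. of_bool (history_prob \<X> (\<nu> \<omega>) 1 h = 0) * of_bool (history 1 (X \<omega>) = h) \<partial>M)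
        = (\<integral>\<omega>. of_bool (history_prob \<X> (\<nu> \<omega>) 1 h = 0) * history_prob \<X> (\<nu> \<omega>) 1 h \<partial>M)"
      by (rule integral_history_eq[OF U, of 1]) simp
    also have "\<dots> = (\<integral>\<omega>. 0 \<partial>M)"
      by (rule Bochner_Integration.integral_cong) auto
    finally have "(\<integral>\<omega>. of_bool (history_prob \<X> (\<nu> \<omega>) 1 h = 0) * of_bool (history 1 (X \<omega>) = h) \<partial>M) = (0 :: real)"
      by simp
    moreover have "integrable M (\<lambda>\<omega>. of_bool (history_prob \<X> (\<nu> \<omega>) 1 h = 0) * of_bool (history 1 (X \<omega>) = h) :: real)"
      by (rule integrable_boundedI[of _ 1, OF m]) simp
    ultimately show ?thesis
      by (subst (asm) integral_nonneg_eq_0_iff_AE) simp_all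
  qed
  then have "AE \<omega> in M. \<forall>h\<in>history 1 ` \<X>.
      of_bool (history_prob \<X> (\<nu> \<omega>) 1 h = 0) * of_bool (history 1 (X \<omega>) = h) = (0 :: real)"
    using finite_paths by (intro AE_finite_allI) auto
  with AE_space show ?thesis
  proof eventually_elim
    case (elim \<omega>)
    then have "history_prob \<X> (\<nu> \<omega>) 1 (history 1 (X \<omega>)) \<noteq> 0"
      using X_in[of \<omega>] by fastforce
    with history_prob_01(1)[OF elim(1)] show ?case by (simp add: less_le)
  qed
qed

text \<open>
  A version for \<open>V\<^sub>1\<close> given \<open>(A, X\<^sub>1)\<close>, read as a kernel in \<open>(A, X\<^sup>t)\<close>, also serves for \<open>V\<^sub>t\<close>: the
  hypothesis identifies the two up to the factor \<open>\<nu>\<^sub>1(X\<^sub>1)\<close>, which is almost surely positive.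
\<close>

lemma same_cond_distr_of_weighted_eq:
  fixes Y Y1 :: "'a \<Rightarrow> real"
  assumes Y: "Y \<in> borel_measurable M" and Y1: "Y1 \<in> borel_measurable M" and t: "1 \<le> t"
    and eq: "\<And>x B C. x \<in> \<X> \<Longrightarrow> B \<in> sets borel \<Longrightarrow> C \<in> sets borel \<Longrightarrow>
      (\<integral>\<omega>. indicator C (A \<omega>) * of_bool (history t (X \<omega>) = history t x) * history_prob \<X> (\<nu> \<omega>) 1 (history 1 x)
        * indicator B (Y \<omega>) \<partial>M)
      = (\<integral>\<omega>. indicator C (A \<omega>) * of_bool (X \<omega> 1 = x 1) * history_prob \<X> (\<nu> \<omega>) t (history t x)
        * (indicator B (Y1 \<omega>) :: real) \<partial>M)"
  shows "same_cond_distr M borel Y (history_space t) (\<lambda>\<omega>. (A \<omega>, history t (X \<omega>)))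
    Y1 initial_space (\<lambda>\<omega>. (A \<omega>, X \<omega> 1))"
proof -
  obtain \<kappa> where \<kappa>: "regular_cond_distr M borel Y1 initial_space (\<lambda>\<omega>. (A \<omega>, X \<omega> 1)) \<kappa>"
    using regular_cond_distr_exists[OF Y1 initial_measurable] by blast
  then have \<kappa>m: "\<kappa> \<in> initial_space \<rightarrow>\<^sub>M prob_algebra borel"
    by (simp add: regular_cond_distr_def)
  have h1: "history t x 1 = x 1" for x :: "nat \<Rightarrow> 'c"
    using t by (simp add: history_def)
  define \<kappa>t where "\<kappa>t p = \<kappa> (fst p, snd p 1)" for p :: "real \<times> (nat \<Rightarrow> 'c)"
  have "(\<lambda>p. snd p 1) \<in> history_space t \<rightarrow>\<^sub>M count_space ((\<lambda>x. x 1) ` \<X>)"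
    by (rule measurable_compose[OF measurable_snd]) (auto simp: h1 simp del: One_nat_def)
  then have \<kappa>tm: "\<kappa>t \<in> history_space t \<rightarrow>\<^sub>M prob_algebra borel"
    unfolding \<kappa>t_def by (intro measurable_compose[OF _ \<kappa>m] measurable_Pair measurable_fst)
  have \<kappa>t: "\<kappa>t (A \<omega>, history t (X \<omega>)) = \<kappa> (A \<omega>, X \<omega> 1)" for \<omega>
    by (simp add: \<kappa>t_def h1 del: One_nat_def)
  let ?Z = "\<lambda>\<omega>. (A \<omega>, history t (X \<omega>))"
  let ?S = "vimage_algebra (space M) ?Z (history_space t)"
  interpret S: sigma_finite_subalgebra M ?S
    by (rule subalgebra_vimage(2)[OF history_measurable])
  define p where "p \<omega> = history_prob \<X> (\<nu> \<omega>) 1 (history 1 (X \<omega>))" for \<omega>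
  have ZS: "?Z \<in> ?S \<rightarrow>\<^sub>M history_space t"
    using measurable_space[OF history_measurable] by (intro measurable_vimage_algebra1) auto
  have obS: "(\<lambda>\<omega>. of_bool (P (history t (X \<omega>))) :: real) \<in> borel_measurable ?S" for P
  proof -
    from measurable_compose[OF ZS measurable_snd]
    have "(\<lambda>\<omega>. history t (X \<omega>)) \<in> ?S \<rightarrow>\<^sub>M count_space (history t ` \<X>)" by simp
    then show ?thesis by (rule measurable_compose[where g="\<lambda>h. of_bool (P h)"]) simp
  qed
  \<comment> \<open>The sum over the finitely many histories displays \<open>p\<close> through
    \<open>A\<close> and the history alone, which yields its measurability
    \<open>pS\<close>.\<close>
  have p_sum: "p \<omega> = (\<Sum>h\<in>history t ` \<X>. history_prob \<X> (\<nu> \<omega>) 1 (history 1 h) * of_bool (history t (X \<omega>) = h))"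
    if "\<omega> \<in> space M" for \<omega>
  proof -
    have "history 1 (history t (X \<omega>)) = history 1 (X \<omega>)"
      by (simp only: history_1_eq_iff h1)
    moreover have "(\<Sum>h\<in>history t ` \<X>. history_prob \<X> (\<nu> \<omega>) 1 (history 1 h) * of_bool (history t (X \<omega>) = h))
      = (\<Sum>h\<in>history t ` \<X>. if h = history t (X \<omega>) then history_prob \<X> (\<nu> \<omega>) 1 (history 1 h) else 0)"
      by (intro sum.cong) auto
    ultimately show ?thesis
      using X_in[OF that] finite_paths by (simp add: p_def sum.delta del: One_nat_def)
  qed
  have pS: "p \<in> borel_measurable ?S"
  proof (subst measurable_cong)
    show "(\<lambda>\<omega>. \<Sum>h\<in>history t ` \<X>. history_prob \<X> (\<nu> \<omega>) 1 (history 1 h) * of_bool (history t (X \<omega>) = h)) \<in> borel_measurable ?S"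
      by (intro borel_measurable_sum borel_measurable_times obS
          measurable_G_finer[OF history_prob_measurable_G history_measurable])
  qed (simp add: p_sum)
  note pM = measurable_from_subalg[OF S.subalg pS]
  have p01: "\<bar>p \<omega>\<bar> \<le> 1" if "\<omega> \<in> space M" for \<omega>
    using history_prob_01[OF that] by (simp add: p_def)
  have "AE \<omega> in M. measure (\<kappa>t (A \<omega>, history t (X \<omega>))) B
      = real_cond_exp M ?S (indicator (Y -` B \<inter> space M)) \<omega>" if B: "B \<in> sets borel" for B
  proof -
    have Bm: "(indicator (Y -` B \<inter> space M) :: 'a \<Rightarrow> real) \<in> borel_measurable M"
      by (rule borel_measurable_indicator[OF measurable_sets[OF Y B]])
    define k where "k \<omega> = measure (\<kappa> (A \<omega>, X \<omega> 1)) B" for \<omega>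
    have kS: "k \<in> borel_measurable ?S"
      using measurable_compose[OF measurable_compose[OF ZS \<kappa>tm] measurable_measure_prob_algebra[OF B]]
      unfolding k_def[abs_def] \<kappa>t .
    note kM = measurable_from_subalg[OF S.subalg kS]
    have k1: "\<bar>k \<omega>\<bar> \<le> 1" if "\<omega> \<in> space M" for \<omega>
      unfolding k_def using X_in[OF that] by (intro kernel_measurable_G(2)[OF \<kappa>m _ B]) auto
    have i1: "integrable M (\<lambda>\<omega>. p \<omega> * indicator (Y -` B \<inter> space M) \<omega>)"
      by (intro integrable_boundedI[of _ 1] borel_measurable_times pM Bm abs_mult_le_of_le_1 p01)
        (auto split: split_indicator)
    have i2: "integrable M (\<lambda>\<omega>. p \<omega> * k \<omega>)"
      by (intro integrable_boundedI[of _ 1] borel_measurable_times pM kM abs_mult_le_of_le_1 p01 k1)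
    \<comment> \<open>The hypothesis supplies the indicator of \<open>Y\<close> only together with
      the factor \<open>p\<close>. Hence the conditional expectation of the product is identified
      first; \<open>p\<close> is pulled out and cancelled afterwards.\<close>
    have "AE \<omega> in M. real_cond_exp M ?S (\<lambda>\<omega>. p \<omega> * indicator (Y -` B \<inter> space M) \<omega>) \<omega> = p \<omega> * k \<omega>"
    proof (rule S.real_cond_exp_charact[OF _ i1 i2 borel_measurable_times[OF pS kS]])
      fix D assume "D \<in> sets ?S"
      then obtain C where C: "C \<in> sets (history_space t)" "D = ?Z -` C \<inter> space M"
        using measurable_space[OF history_measurable] by (auto simp: sets_vimage_algebra2)
      have CU: "(\<lambda>\<omega>. indicator {a. (a, h) \<in> C} (A \<omega>) :: real) \<in> borel_measurable \<G>"
        and Ch: "{a. (a, h) \<in> C} \<in> sets borel" if "h \<in> history t ` \<X>" for h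
      proof -
        have "(\<lambda>a. (a, h)) \<in> borel \<rightarrow>\<^sub>M history_space t"
          using that by (intro measurable_Pair measurable_const) auto
        from measurable_sets[OF this C(1)] show *: "{a. (a, h) \<in> C} \<in> sets borel"
          by (simp add: vimage_def)
        show "(\<lambda>\<omega>. indicator {a. (a, h) \<in> C} (A \<omega>) :: real) \<in> borel_measurable \<G>"
          by (rule measurable_compose[OF A_measurable_G borel_measurable_indicator[OF *]])
      qed
      \<comment> \<open>The second coordinate of \<open>C\<close> is discrete. So \<open>D\<close>
        splits into finitely many events, on each of which the history is some \<open>h\<close> and
        \<open>A\<close> lies in the slice of \<open>C\<close> at \<open>h\<close>.\<close>
      have split: "(\<integral>\<omega>\<in>D. p \<omega> * F \<omega> \<partial>M) = (\<Sum>h\<in>history t ` \<X>. \<integral>\<omega>. indicator {a. (a, h) \<in> C} (A \<omega>)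
          * of_bool (history t (X \<omega>) = h) * history_prob \<X> (\<nu> \<omega>) 1 (history 1 h) * F \<omega> \<partial>M)"
        if F: "F \<in> borel_measurable M" "\<And>\<omega>. \<omega> \<in> space M \<Longrightarrow> \<bar>F \<omega> :: real\<bar> \<le> 1" for F
      proof -
        have "(\<integral>\<omega>\<in>D. p \<omega> * F \<omega> \<partial>M) = (\<integral>\<omega>. (\<Sum>h\<in>history t ` \<X>. indicator {a. (a, h) \<in> C} (A \<omega>)
          * of_bool (history t (X \<omega>) = h) * history_prob \<X> (\<nu> \<omega>) 1 (history 1 h) * F \<omega>) \<partial>M)"
          unfolding set_lebesgue_integral_def
        proof (rule Bochner_Integration.integral_cong[OF refl])
          fix \<omega> assume w: "\<omega> \<in> space M"
          have "(\<Sum>h\<in>history t ` \<X>. indicator {a. (a, h) \<in> C} (A \<omega>)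
              * of_bool (history t (X \<omega>) = h) * history_prob \<X> (\<nu> \<omega>) 1 (history 1 h) * F \<omega>)
            = (\<Sum>h\<in>history t ` \<X>. if h = history t (X \<omega>) then indicator {a. (a, h) \<in> C} (A \<omega>)
              * history_prob \<X> (\<nu> \<omega>) 1 (history 1 h) * F \<omega> else 0)"
            by (intro sum.cong) auto
          also have "\<dots> = indicator {a. (a, history t (X \<omega>)) \<in> C} (A \<omega>)
              * history_prob \<X> (\<nu> \<omega>) 1 (history 1 (history t (X \<omega>))) * F \<omega>"
            using X_in[OF w] finite_paths by (simp add: sum.delta' del: One_nat_def)
          also have "history 1 (history t (X \<omega>)) = history 1 (X \<omega>)"
            by (simp only: history_1_eq_iff h1)
          finally show "indicat_real D \<omega> *\<^sub>R (p \<omega> * F \<omega>) = (\<Sum>h\<in>history t ` \<X>. indicator {a. (a, h) \<in> C} (A \<omega>)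
              * of_bool (history t (X \<omega>) = h) * history_prob \<X> (\<nu> \<omega>) 1 (history 1 h) * F \<omega>)"
            using w by (simp add: C(2) p_def indicator_def del: One_nat_def)
        qed
        also have "\<dots> = (\<Sum>h\<in>history t ` \<X>. \<integral>\<omega>. indicator {a. (a, h) \<in> C} (A \<omega>)
          * of_bool (history t (X \<omega>) = h) * history_prob \<X> (\<nu> \<omega>) 1 (history 1 h) * F \<omega> \<partial>M)"
          by (intro Bochner_Integration.integral_sum integrable_boundedI[of _ 1] borel_measurable_times F
              of_bool_path_measurable measurable_from_subalg[OF G.subalg history_prob_measurable_G]
              measurable_from_subalg[OF G.subalg CU] abs_mult_le_of_le_1)
            (auto simp: history_prob_01 simp del: One_nat_def)
        finally show ?thesis .
      qed
      \<comment> \<open>The hypothesis passes from \<open>Y\<close> to \<open>Y1\<close> and swaps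
        the weights; the exchange lemma swaps them back and leaves the kernel of \<open>Y1\<close>
        in place of its indicator.\<close>
      have summand: "(\<integral>\<omega>. indicator {a. (a, h) \<in> C} (A \<omega>) * of_bool (history t (X \<omega>) = h)
            * history_prob \<X> (\<nu> \<omega>) 1 (history 1 h) * indicator (Y -` B \<inter> space M) \<omega> \<partial>M)
          = (\<integral>\<omega>. indicator {a. (a, h) \<in> C} (A \<omega>) * of_bool (history t (X \<omega>) = h)
            * history_prob \<X> (\<nu> \<omega>) 1 (history 1 h) * k \<omega> \<partial>M)" if h: "h \<in> history t ` \<X>" for h
      proof -
        obtain x where x: "x \<in> \<X>" "h = history t x" using h by auto
        have hx: "history 1 h = history 1 x" unfolding x(2) by (simp only: history_1_eq_iff h1)
        let ?c = "\<lambda>\<omega>. indicator {a. (a, h) \<in> C} (A \<omega>) :: real"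
        have "(\<integral>\<omega>. ?c \<omega> * of_bool (history t (X \<omega>) = h) * history_prob \<X> (\<nu> \<omega>) 1 (history 1 h) * indicator (Y -` B \<inter> space M) \<omega> \<partial>M)
            = (\<integral>\<omega>. ?c \<omega> * of_bool (history t (X \<omega>) = history t x) * history_prob \<X> (\<nu> \<omega>) 1 (history 1 x) * indicator B (Y \<omega>) \<partial>M)"
          unfolding hx unfolding x(2) by (intro Bochner_Integration.integral_cong) (auto simp: indicator_def)
        also have "\<dots> = (\<integral>\<omega>. ?c \<omega> * of_bool (X \<omega> 1 = x 1) * history_prob \<X> (\<nu> \<omega>) t (history t x) * indicator B (Y1 \<omega>) \<partial>M)"
          by (rule eq[OF x(1) B Ch[OF h]])
        also have "\<dots> = (\<integral>\<omega>. ?c \<omega> * of_bool (history t (X \<omega>) = history t x) * history_prob \<X> (\<nu> \<omega>) 1 (history 1 x) * measure (\<kappa> (A \<omega>, x 1)) B \<partial>M)"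
          by (rule integral_initial_exchange[OF \<kappa> Y1 x(1) B CU[OF h], of 1]) (auto split: split_indicator)
        also have "\<dots> = (\<integral>\<omega>. ?c \<omega> * of_bool (history t (X \<omega>) = h) * history_prob \<X> (\<nu> \<omega>) 1 (history 1 h) * k \<omega> \<partial>M)"
          unfolding hx unfolding x(2) k_def
        proof (rule Bochner_Integration.integral_cong[OF refl])
          fix \<omega>
          show "indicator {a. (a, history t x) \<in> C} (A \<omega>) * of_bool (history t (X \<omega>) = history t x)
              * history_prob \<X> (\<nu> \<omega>) 1 (history 1 x) * measure (\<kappa> (A \<omega>, x 1)) B
            = indicator {a. (a, history t x) \<in> C} (A \<omega>) * of_bool (history t (X \<omega>) = history t x)
              * history_prob \<X> (\<nu> \<omega>) 1 (history 1 x) * measure (\<kappa> (A \<omega>, X \<omega> 1)) B"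
            using history_eq_imp_eq_1[of t "X \<omega>" x] t
            by (cases "history t (X \<omega>) = history t x") (simp_all del: One_nat_def)
        qed
        finally show ?thesis .
      qed
      have "(\<integral>\<omega>\<in>D. p \<omega> * indicator (Y -` B \<inter> space M) \<omega> \<partial>M)
          = (\<Sum>h\<in>history t ` \<X>. \<integral>\<omega>. indicator {a. (a, h) \<in> C} (A \<omega>) * of_bool (history t (X \<omega>) = h)
            * history_prob \<X> (\<nu> \<omega>) 1 (history 1 h) * indicator (Y -` B \<inter> space M) \<omega> \<partial>M)"
        by (rule split[OF Bm]) (auto split: split_indicator)
      also have "\<dots> = (\<Sum>h\<in>history t ` \<X>. \<integral>\<omega>. indicator {a. (a, h) \<in> C} (A \<omega>) * of_bool (history t (X \<omega>) = h)
            * history_prob \<X> (\<nu> \<omega>) 1 (history 1 h) * k \<omega> \<partial>M)"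
        by (rule sum.cong[OF refl summand])
      also have "\<dots> = (\<integral>\<omega>\<in>D. p \<omega> * k \<omega> \<partial>M)"
        by (rule split[OF kM k1, symmetric])
      finally show "(\<integral>\<omega>\<in>D. p \<omega> * indicator (Y -` B \<inter> space M) \<omega> \<partial>M) = (\<integral>\<omega>\<in>D. p \<omega> * k \<omega> \<partial>M)" .
    qed
    moreover have "AE \<omega> in M. real_cond_exp M ?S (\<lambda>\<omega>. p \<omega> * indicator (Y -` B \<inter> space M) \<omega>) \<omega>
        = p \<omega> * real_cond_exp M ?S (indicator (Y -` B \<inter> space M)) \<omega>"
      by (rule S.real_cond_exp_mult[OF pS Bm i1])
    ultimately show ?thesis
      using initial_prob_pos
    proof eventually_elim
      case (elim \<omega>)
      from elim(1) have "p \<omega> * k \<omega> = p \<omega> * real_cond_exp M ?S (indicator (Y -` B \<inter> space M)) \<omega>"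
        unfolding elim(2) by (rule sym)
      with elim(3) show ?case unfolding \<kappa>t k_def p_def by (simp del: One_nat_def)
    qed
  qed
  then have "regular_cond_distr M borel Y (history_space t) ?Z \<kappa>t"
    unfolding regular_cond_distr_def using \<kappa>tm by blast
  with \<kappa> show ?thesis
    unfolding same_cond_distr_def by (intro exI[of _ \<kappa>t] exI[of _ \<kappa>]) (simp add: \<kappa>t del: One_nat_def)
qed

end

section \<open>The two directions\<close>

text \<open>Both restrictions rest on \<open>r (\<nu> \<omega>)\<close> being measurable in
  \<open>A\<close>: the first is then the defining property of Pr(X = x | A), the second the
  weighted identity for \<open>V\<close>, transported to \<open>A - V\<close>.\<close>

lemma (in path_process) exogenous_law_in_Gamma_laws:
  assumes ex: "sequentially_exogenous T \<X> M X V A"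
    and V: "V \<in> M \<rightarrow>\<^sub>M (\<Pi>\<^sub>M t\<in>{1..T}. borel)"
  shows "distr M (law_space T \<X>) (\<lambda>\<omega>. (X \<omega>, \<lambda>t\<in>{1..T}. A \<omega> - V \<omega> t, \<nu> \<omega>)) \<in> Gamma_laws T \<X>"
proof -
  have Vm: "(\<lambda>\<omega>. V \<omega> t) \<in> borel_measurable M" if "t \<in> {1..T}" for t
    by (rule measurable_compose[OF V measurable_component_singleton[OF that]])
  have V': "(\<lambda>\<omega>. \<lambda>t\<in>{1..T}. A \<omega> - V \<omega> t) \<in> M \<rightarrow>\<^sub>M (\<Pi>\<^sub>M t\<in>{1..T}. borel)"
    by (intro measurable_restrict borel_measurable_diff A Vm)
  have r_bd: "\<exists>c. \<forall>\<omega>\<in>space M. \<bar>r (\<nu> \<omega>)\<bar> \<le> c" if r: "bounded (r ` prob_simplex \<X>)"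
    for r :: "((nat \<Rightarrow> 'c) \<Rightarrow> real) \<Rightarrow> real"
    using r \<nu>_in unfolding bounded_iff by fastforce
  show ?thesis
    unfolding distr_mem_Gamma_laws_iff[OF prob_space_axioms X V' \<nu>_measurable]
  proof (intro ballI impI conjI)
    fix r :: "((nat \<Rightarrow> 'c) \<Rightarrow> real) \<Rightarrow> real" and x
    assume r: "r \<in> borel_measurable (simplex_space \<X>)" "bounded (r ` prob_simplex \<X>)" and x: "x \<in> \<X>"
    obtain c where c: "\<And>\<omega>. \<omega> \<in> space M \<Longrightarrow> \<bar>r (\<nu> \<omega>)\<bar> \<le> c"
      using r_bd[OF r(2)] by blast
    have rG: "(\<lambda>\<omega>. r (\<nu> \<omega>)) \<in> borel_measurable \<G>"
      by (rule measurable_compose[OF \<nu> r(1)])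
    note rM = measurable_from_subalg[OF G.subalg rG]
    have "integrable M (\<lambda>\<omega>. r (\<nu> \<omega>) * of_bool (X \<omega> = x))"
      by (intro integrable_boundedI[of _ c] borel_measurable_times rM of_bool_path_measurable abs_mult_le_of_le_1 c) simp_all
    moreover have "integrable M (\<lambda>\<omega>. r (\<nu> \<omega>) * \<nu> \<omega> x)"
      using prob_simplex_le_1[OF finite_paths \<nu>_in x]
      by (intro integrable_boundedI[of _ c] borel_measurable_times rM abs_mult_le_of_le_1 c
          measurable_compose[OF \<nu>_measurable measurable_simplex_component[OF x]]) auto
    ultimately have "(\<integral>\<omega>. r (\<nu> \<omega>) * (of_bool (X \<omega> = x) - \<nu> \<omega> x) \<partial>M)
        = (\<integral>\<omega>. r (\<nu> \<omega>) * of_bool (X \<omega> = x) \<partial>M) - (\<integral>\<omega>. r (\<nu> \<omega>) * \<nu> \<omega> x \<partial>M)"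
      unfolding right_diff_distrib by (rule Bochner_Integration.integral_diff)
    also have "\<dots> = 0"
      using integral_path_eq[OF rG c x] by simp
    finally show "(\<integral>\<omega>. r (\<nu> \<omega>) * (of_bool (X \<omega> = x) - \<nu> \<omega> x) \<partial>M) = 0" .
  next
    fix r :: "((nat \<Rightarrow> 'c) \<Rightarrow> real) \<Rightarrow> real" and f :: "real \<Rightarrow> real" and x t
    assume r: "r \<in> borel_measurable (simplex_space \<X>)" "bounded (r ` prob_simplex \<X>)"
      and f: "f \<in> borel_measurable borel" "bounded (range f)" and x: "x \<in> \<X>" and t: "t \<in> {2..T}"
    obtain c where c: "\<And>\<omega>. \<omega> \<in> space M \<Longrightarrow> \<bar>r (\<nu> \<omega>)\<bar> \<le> c"
      using r_bd[OF r(2)] by blast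
    obtain d where d: "\<And>y. \<bar>f y\<bar> \<le> d"
      using f(2) unfolding bounded_iff by auto
    from t have t1: "1 \<in> {1..T}" "t \<in> {1..T}" by auto
    let ?w = "\<lambda>\<omega>. of_bool (history t (X \<omega>) = history t x) * history_prob \<X> (\<nu> \<omega>) 1 (history 1 x)"
    let ?w' = "\<lambda>\<omega>. of_bool (X \<omega> 1 = x 1) * history_prob \<X> (\<nu> \<omega>) t (history t x)"
    \<comment> \<open>\<open>g\<close> carries the test function \<open>r\<close> together with the
      shift to \<open>A - V\<close>. Its first argument is a pair because \<open>r\<close> needs
      \<open>\<nu>\<close> while the shift needs \<open>A\<close>.\<close>
    define g where "g p = r (snd (fst p)) * f (fst (fst p) - snd p)" for p :: "(real \<times> ((nat \<Rightarrow> 'c) \<Rightarrow> real)) \<times> real"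
    have Z: "(\<lambda>\<omega>. (A \<omega>, \<nu> \<omega>)) \<in> \<G> \<rightarrow>\<^sub>M borel \<Otimes>\<^sub>M simplex_space \<X>"
      by (rule measurable_Pair[OF A_measurable_G \<nu>])
    note ZM = measurable_from_subalg[OF G.subalg Z]
    have wm: "?w \<in> borel_measurable M" "?w' \<in> borel_measurable M"
      by (intro borel_measurable_times of_bool_path_measurable measurable_from_subalg[OF G.subalg history_prob_measurable_G])+
    have wb: "0 \<le> ?w \<omega>" "?w \<omega> \<le> 1" "0 \<le> ?w' \<omega>" "?w' \<omega> \<le> 1" if "\<omega> \<in> space M" for \<omega>
      using history_prob_01[OF that] by (auto simp: of_bool_def simp del: One_nat_def)
    have gm: "g \<in> borel_measurable ((borel \<Otimes>\<^sub>M simplex_space \<X>) \<Otimes>\<^sub>M borel)"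
      unfolding g_def
      by (intro borel_measurable_times measurable_compose[OF _ r(1)] measurable_compose[OF _ f(1)] borel_measurable_diff)
        measurable
    have key: "(\<integral>\<omega>. ?w \<omega> * g ((A \<omega>, \<nu> \<omega>), V \<omega> t) \<partial>M) = (\<integral>\<omega>. ?w' \<omega> * g ((A \<omega>, \<nu> \<omega>), V \<omega> 1) \<partial>M)"
    proof (rule integral_weighted_eq_of_rectangles[OF prob_space_axioms ZM Vm[OF t1(2)] Vm[OF t1(1)] wm wb _ gm])
      fix C :: "(real \<times> ((nat \<Rightarrow> 'c) \<Rightarrow> real)) set" and B :: "real set"
      assume C: "C \<in> sets (borel \<Otimes>\<^sub>M simplex_space \<X>)" and B: "B \<in> sets borel"
      have "(\<lambda>\<omega>. indicator C (A \<omega>, \<nu> \<omega>) :: real) \<in> borel_measurable \<G>"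
        by (rule measurable_compose[OF Z borel_measurable_indicator[OF C]])
      from sequentially_exogenous_imp_weighted_eq[OF ex Vm t x B this, of 1]
      show "(\<integral>\<omega>. ?w \<omega> * (indicator C (A \<omega>, \<nu> \<omega>) * indicator B (V \<omega> t)) \<partial>M)
          = (\<integral>\<omega>. ?w' \<omega> * (indicator C (A \<omega>, \<nu> \<omega>) * indicator B (V \<omega> 1)) \<partial>M)"
        by (simp add: mult_ac del: One_nat_def)
    qed
    have gb: "\<bar>g ((A \<omega>, \<nu> \<omega>), y)\<bar> \<le> c * d" if "\<omega> \<in> space M" for \<omega> y
      unfolding g_def abs_mult using c[OF that] d by (auto intro!: mult_mono order_trans[OF abs_ge_zero c[OF that]])
    have int: "integrable M (\<lambda>\<omega>. u \<omega> * g ((A \<omega>, \<nu> \<omega>), V \<omega> s))"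
      if s: "s \<in> {1..T}" and u: "u \<in> borel_measurable M" "\<And>\<omega>. \<omega> \<in> space M \<Longrightarrow> 0 \<le> u \<omega>" "\<And>\<omega>. \<omega> \<in> space M \<Longrightarrow> u \<omega> \<le> 1"
      for u s
      unfolding mult.commute[of "u _"]
      by (intro integrable_boundedI[of _ "c * d"] borel_measurable_times u(1) abs_mult_le_of_le_1 gb
          measurable_compose[OF measurable_Pair[OF ZM Vm[OF s]] gm]) (use u in auto)
    have "(\<integral>\<omega>. r (\<nu> \<omega>) *
        (f ((\<lambda>t\<in>{1..T}. A \<omega> - V \<omega> t) t) * of_bool (history t (X \<omega>) = history t x) * history_prob \<X> (\<nu> \<omega>) 1 (history 1 x)
          - f ((\<lambda>t\<in>{1..T}. A \<omega> - V \<omega> t) 1) * of_bool (X \<omega> 1 = x 1) * history_prob \<X> (\<nu> \<omega>) t (history t x)) \<partial>M)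
      = (\<integral>\<omega>. ?w \<omega> * g ((A \<omega>, \<nu> \<omega>), V \<omega> t) - ?w' \<omega> * g ((A \<omega>, \<nu> \<omega>), V \<omega> 1) \<partial>M)"
      using t1 by (intro Bochner_Integration.integral_cong)
        (simp_all add: g_def algebra_simps del: One_nat_def)
    also have "\<dots> = (\<integral>\<omega>. ?w \<omega> * g ((A \<omega>, \<nu> \<omega>), V \<omega> t) \<partial>M) - (\<integral>\<omega>. ?w' \<omega> * g ((A \<omega>, \<nu> \<omega>), V \<omega> 1) \<partial>M)"
      by (intro Bochner_Integration.integral_diff int t1 wm wb)
    finally show "(\<integral>\<omega>. r (\<nu> \<omega>) *
        (f ((\<lambda>t\<in>{1..T}. A \<omega> - V \<omega> t) t) * of_bool (history t (X \<omega>) = history t x) * history_prob \<X> (\<nu> \<omega>) 1 (history 1 x)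
          - f ((\<lambda>t\<in>{1..T}. A \<omega> - V \<omega> t) 1) * of_bool (X \<omega> 1 = x 1) * history_prob \<X> (\<nu> \<omega>) t (history t x)) \<partial>M) = 0"
      unfolding key by simp
  qed
qed

text \<open>
  The path probabilities are only almost surely a function of \<open>A\<close>; this makes them exactly so.
\<close>

lemma (in prob_space) cond_prob_path_modification:
  assumes fin: "finite \<X>" and A: "A \<in> borel_measurable M"
    and \<nu>: "\<nu> \<in> M \<rightarrow>\<^sub>M simplex_space \<X>" and cp: "is_cond_prob_path \<X> M X A \<nu>"
  obtains \<mu> where "\<mu> \<in> vimage_algebra (space M) A borel \<rightarrow>\<^sub>M simplex_space \<X>" "AE \<omega> in M. \<nu> \<omega> = \<mu> \<omega>"
proof -
  let ?G = "vimage_algebra (space M) A borel"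
  obtain \<omega>0 where w0: "\<omega>0 \<in> space M" using not_empty by auto
  have in_simplex: "\<nu> \<omega> \<in> prob_simplex \<X>" if "\<omega> \<in> space M" for \<omega>
    using measurable_space[OF \<nu> that] by (simp add: space_simplex_space)
  define c where "c \<omega> = restrict (\<lambda>x. real_cond_exp M ?G (indicator {\<omega> \<in> space M. X \<omega> = x}) \<omega>) \<X>" for \<omega>
  \<comment> \<open>The chosen conditional probabilities may leave the simplex on a null set. A
    constant point of the simplex is substituted there, because \<open>\<nu> \<omega>\<close> in its
    place need not be measurable in \<open>A\<close>.\<close>
  define \<mu> where "\<mu> \<omega> = (if c \<omega> \<in> prob_simplex \<X> then c \<omega> else \<nu> \<omega>0)" for \<omega>
  have cm[measurable]: "(\<lambda>\<omega>. c \<omega> x) \<in> borel_measurable ?G" if "x \<in> \<X>" for x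
    using that by (simp add: c_def)
  have mem: "c \<omega> \<in> prob_simplex \<X> \<longleftrightarrow> (\<forall>x\<in>\<X>. 0 \<le> c \<omega> x) \<and> (\<Sum>x\<in>\<X>. c \<omega> x) = 1" for \<omega>
    by (auto simp: prob_simplex_def PiE_iff c_def)
  have S: "{\<omega> \<in> space ?G. c \<omega> \<in> prob_simplex \<X>} \<in> sets ?G"
    unfolding mem using fin by measurable
  have "\<mu> \<in> ?G \<rightarrow>\<^sub>M simplex_space \<X>"
  proof (rule measurable_into_simplex_space)
    show "(\<lambda>\<omega>. \<mu> \<omega> x) \<in> borel_measurable ?G" if x: "x \<in> \<X>" for x
    proof -
      have eq: "(\<lambda>\<omega>. \<mu> \<omega> x) = (\<lambda>\<omega>. if c \<omega> \<in> prob_simplex \<X> then c \<omega> x else \<nu> \<omega>0 x)"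
        by (auto simp: \<mu>_def)
      show ?thesis
        unfolding eq by (rule measurable_If[OF cm[OF x] _ S]) simp
    qed
    show "\<mu> \<omega> \<in> prob_simplex \<X>" for \<omega>
      using in_simplex[OF w0] by (simp add: \<mu>_def)
  qed
  moreover have "AE \<omega> in M. \<nu> \<omega> = \<mu> \<omega>"
    using cp[unfolded is_cond_prob_path_def] AE_space
  proof eventually_elim
    case (elim \<omega>)
    have "c \<omega> = \<nu> \<omega>"
    proof
      fix x show "c \<omega> x = \<nu> \<omega> x"
        using elim(1) in_simplex[OF elim(2)]
        by (cases "x \<in> \<X>") (auto simp: c_def prob_simplex_def PiE_iff extensional_def)
    qed
    with in_simplex[OF elim(2)] show ?case by (simp add: \<mu>_def)
  qed
  ultimately show thesis by (rule that)
qed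

text \<open>Altering \<nu> on a null set does not change the law of the triple, so \<nu> may be
  replaced by its version that is measurable in \<open>A\<close>, and \<open>path_process\<close>
  applies.\<close>

lemma exogenous_imp_Gamma_laws:
  assumes M: "prob_space M" and fin: "finite \<X>"
    and X: "X \<in> M \<rightarrow>\<^sub>M count_space \<X>" and V: "V \<in> M \<rightarrow>\<^sub>M (\<Pi>\<^sub>M t\<in>{1..T}. borel)"
    and A: "A \<in> borel_measurable M" and ex: "sequentially_exogenous T \<X> M X V A"
    and \<nu>M: "\<nu> \<in> M \<rightarrow>\<^sub>M simplex_space \<X>" and cp: "is_cond_prob_path \<X> M X A \<nu>"
  shows "distr M (law_space T \<X>) (\<lambda>\<omega>. (X \<omega>, \<lambda>t\<in>{1..T}. A \<omega> - V \<omega> t, \<nu> \<omega>)) \<in> Gamma_laws T \<X>"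
proof -
  interpret prob_space M by fact
  obtain \<mu> where \<mu>: "\<mu> \<in> vimage_algebra (space M) A borel \<rightarrow>\<^sub>M simplex_space \<X>" "AE \<omega> in M. \<nu> \<omega> = \<mu> \<omega>"
    using cond_prob_path_modification[OF fin A \<nu>M cp] .
  have cp': "is_cond_prob_path \<X> M X A \<mu>"
    using cp \<mu>(2) unfolding is_cond_prob_path_def by eventually_elim simp
  interpret path_process M \<X> X A \<mu>
    by unfold_locales (fact fin X A \<mu>(1) cp')+
  have V': "(\<lambda>\<omega>. \<lambda>t\<in>{1..T}. A \<omega> - V \<omega> t) \<in> M \<rightarrow>\<^sub>M (\<Pi>\<^sub>M t\<in>{1..T}. borel)"
    by (intro measurable_restrict borel_measurable_diff A
        measurable_compose[OF V measurable_component_singleton])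
  have m: "(\<lambda>\<omega>. (X \<omega>, \<lambda>t\<in>{1..T}. A \<omega> - V \<omega> t, n \<omega>)) \<in> M \<rightarrow>\<^sub>M law_space T \<X>"
    if "n \<in> M \<rightarrow>\<^sub>M simplex_space \<X>" for n
    unfolding law_space_def by (intro measurable_Pair X V' that)
  have "distr M (law_space T \<X>) (\<lambda>\<omega>. (X \<omega>, \<lambda>t\<in>{1..T}. A \<omega> - V \<omega> t, \<nu> \<omega>))
      = distr M (law_space T \<X>) (\<lambda>\<omega>. (X \<omega>, \<lambda>t\<in>{1..T}. A \<omega> - V \<omega> t, \<mu> \<omega>))"
  proof (rule distr_cong_AE)
    show "AE \<omega> in M. (X \<omega>, \<lambda>t\<in>{1..T}. A \<omega> - V \<omega> t, \<nu> \<omega>) = (X \<omega>, \<lambda>t\<in>{1..T}. A \<omega> - V \<omega> t, \<mu> \<omega>)"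
      using \<mu>(2) by eventually_elim simp
  qed (rule refl m[OF \<nu>M] m[OF \<nu>_measurable])+
  with exogenous_law_in_Gamma_laws[OF ex V] show ?thesis by simp
qed

lemma Gamma_laws_imp_exogenous:
  fixes M :: "'a measure" and \<X> :: "(nat \<Rightarrow> 'c) set"
  assumes M: "prob_space M" and fin: "finite \<X>"
    and X: "X \<in> M \<rightarrow>\<^sub>M count_space \<X>" and V: "V \<in> M \<rightarrow>\<^sub>M (\<Pi>\<^sub>M t\<in>{1..T}. borel)"
    and \<nu>M: "\<nu> \<in> M \<rightarrow>\<^sub>M simplex_space \<X>"
    and \<Gamma>: "distr M (law_space T \<X>) (\<lambda>\<omega>. (X \<omega>, V \<omega>, \<nu> \<omega>)) \<in> Gamma_laws T \<X>"
  obtains a where "a \<in> borel_measurable (simplex_space \<X>)"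
    and "sequentially_exogenous T \<X> M X (\<lambda>\<omega>. \<lambda>t\<in>{1..T}. a (\<nu> \<omega>) - V \<omega> t) (\<lambda>\<omega>. a (\<nu> \<omega>))"
    and "is_cond_prob_path \<X> M X (\<lambda>\<omega>. a (\<nu> \<omega>)) \<nu>"
proof -
  interpret prob_space M by fact
  have "\<X> \<noteq> {}" using not_empty measurable_space[OF X] by auto
  obtain a :: "((nat \<Rightarrow> 'c) \<Rightarrow> real) \<Rightarrow> real" where a: "a \<in> borel_measurable (simplex_space \<X>)"
    and enc: "(\<lambda>\<nu>. \<nu>) \<in> vimage_algebra (prob_simplex \<X>) a borel \<rightarrow>\<^sub>M simplex_space \<X>"
    using simplex_space_real_encoding[OF fin \<open>\<X> \<noteq> {}\<close>] .
  define A where "A \<omega> = a (\<nu> \<omega>)" for \<omega>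
  let ?G = "vimage_algebra (space M) A borel"
  have A: "A \<in> borel_measurable M" unfolding A_def by (rule measurable_compose[OF \<nu>M a])
  have in_simplex: "\<nu> \<omega> \<in> prob_simplex \<X>" if "\<omega> \<in> space M" for \<omega>
    using measurable_space[OF \<nu>M that] by (simp add: space_simplex_space)
  have AG: "A \<in> borel_measurable ?G" by (rule measurable_vimage_algebra1) simp
  \<comment> \<open>\<open>A\<close> is \<open>a\<close> after \<open>\<nu>\<close>, and the
    encoding recovers \<nu> from it. This gives the measurability that \<open>path_process\<close>
    demands.\<close>
  have "\<nu> \<in> ?G \<rightarrow>\<^sub>M vimage_algebra (prob_simplex \<X>) a borel"
  proof (rule measurable_vimage_algebra2)
    show "\<nu> \<in> space ?G \<rightarrow> prob_simplex \<X>" using in_simplex by auto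
    have eq: "(\<lambda>\<omega>. a (\<nu> \<omega>)) = A" by (simp add: A_def fun_eq_iff)
    show "(\<lambda>\<omega>. a (\<nu> \<omega>)) \<in> borel_measurable ?G" unfolding eq by (rule AG)
  qed
  from measurable_compose[OF this enc] have \<nu>G: "\<nu> \<in> ?G \<rightarrow>\<^sub>M simplex_space \<X>" .
  interpret S: sigma_finite_subalgebra M ?G by (rule subalgebra_vimage(2)[OF A])
  note \<Gamma>' = \<Gamma>[unfolded distr_mem_Gamma_laws_iff[OF M X V \<nu>M], THEN bspec, THEN mp]
  have Xm: "(\<lambda>\<omega>. of_bool (P (X \<omega>)) :: real) \<in> borel_measurable M" for P
    by (rule measurable_compose[OF X]) simp
  have cp: "is_cond_prob_path \<X> M X A \<nu>"
    unfolding is_cond_prob_path_def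
  proof (rule AE_finite_allI[OF fin])
    fix x assume x: "x \<in> \<X>"
    have "X -` {x} \<inter> space M \<in> sets M"
      using x by (intro measurable_sets[OF X]) simp
    also have "X -` {x} \<inter> space M = {\<omega> \<in> space M. X \<omega> = x}" by auto
    finally have E: "{\<omega> \<in> space M. X \<omega> = x} \<in> sets M" .
    note \<nu>x = measurable_compose[OF \<nu>M measurable_simplex_component[OF x]]
    have i1: "integrable M (indicator {\<omega> \<in> space M. X \<omega> = x} :: 'a \<Rightarrow> real)"
      by (rule integrable_boundedI[of _ 1, OF borel_measurable_indicator[OF E]]) (auto split: split_indicator)
    have i2: "integrable M (\<lambda>\<omega>. \<nu> \<omega> x)"
      using prob_simplex_le_1[OF fin in_simplex x] by (intro integrable_boundedI[of _ 1, OF \<nu>x]) auto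
    show "AE \<omega> in M. real_cond_exp M ?G (indicator {\<omega> \<in> space M. X \<omega> = x}) \<omega> = \<nu> \<omega> x"
    proof (rule S.real_cond_exp_charact[OF _ i1 i2 measurable_compose[OF \<nu>G measurable_simplex_component[OF x]]])
      fix D assume "D \<in> sets ?G"
      then obtain C where C: "C \<in> sets borel" "D = A -` C \<inter> space M"
        by (auto simp: sets_vimage_algebra2)
      \<comment> \<open>Every event of the \<sigma>-algebra of \<open>A\<close> has the form
        \<open>a (\<nu> \<omega>) \<in> C\<close>, so its indicator is an admissible test function
        of \<nu>. The first restriction thereby becomes the defining property of conditional
        probability.\<close>
      define r where "r n = (indicator C (a n) :: real)" for n
      have r: "r \<in> borel_measurable (simplex_space \<X>)"
        unfolding r_def by (rule measurable_compose[OF a borel_measurable_indicator[OF C(1)]])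
      have rb: "bounded (r ` prob_simplex \<X>)"
        unfolding bounded_iff by (auto simp: r_def intro!: exI[of _ 1] split: split_indicator)
      have "(\<integral>\<omega>. r (\<nu> \<omega>) * (of_bool (X \<omega> = x) - \<nu> \<omega> x) \<partial>M) = 0"
        by (rule bspec[OF conjunct1[OF \<Gamma>'[OF r rb]] x])
      also have "(\<integral>\<omega>. r (\<nu> \<omega>) * (of_bool (X \<omega> = x) - \<nu> \<omega> x) \<partial>M)
          = (\<integral>\<omega>. indicator D \<omega> *\<^sub>R indicator {\<omega> \<in> space M. X \<omega> = x} \<omega> - indicator D \<omega> *\<^sub>R \<nu> \<omega> x \<partial>M)"
        by (intro Bochner_Integration.integral_cong) (auto simp: r_def C(2) A_def indicator_def)
      also have "\<dots> = (\<integral>\<omega>\<in>D. indicator {\<omega> \<in> space M. X \<omega> = x} \<omega> \<partial>M) - (\<integral>\<omega>\<in>D. \<nu> \<omega> x \<partial>M)"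
        unfolding set_lebesgue_integral_def C(2)
        by (intro Bochner_Integration.integral_diff integrable_mult_indicator i1 i2 measurable_sets[OF A C(1)])
      finally show "(\<integral>\<omega>\<in>D. indicator {\<omega> \<in> space M. X \<omega> = x} \<omega> \<partial>M) = (\<integral>\<omega>\<in>D. \<nu> \<omega> x \<partial>M)" by simp
    qed
  qed
  interpret path_process M \<X> X A \<nu>
    by unfold_locales (fact fin X A \<nu>G cp)+
  have Vm: "(\<lambda>\<omega>. V \<omega> t) \<in> borel_measurable M" if "t \<in> {1..T}" for t
    by (rule measurable_compose[OF V measurable_component_singleton[OF that]])
  have "sequentially_exogenous T \<X> M X (\<lambda>\<omega>. \<lambda>t\<in>{1..T}. A \<omega> - V \<omega> t) A"
    unfolding sequentially_exogenous_def
  proof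
    fix t assume t: "t \<in> {2..T}"
    then have t1: "1 \<in> {1..T}" "t \<in> {1..T}" "1 \<le> t" by auto
    have "same_cond_distr M borel (\<lambda>\<omega>. A \<omega> - V \<omega> t) (history_space t) (\<lambda>\<omega>. (A \<omega>, history t (X \<omega>)))
      (\<lambda>\<omega>. A \<omega> - V \<omega> 1) initial_space (\<lambda>\<omega>. (A \<omega>, X \<omega> 1))"
    proof (rule same_cond_distr_of_weighted_eq)
      show "(\<lambda>\<omega>. A \<omega> - V \<omega> t) \<in> borel_measurable M" "(\<lambda>\<omega>. A \<omega> - V \<omega> 1) \<in> borel_measurable M"
        by (intro borel_measurable_diff A Vm t1)+
      show "1 \<le> t" by fact
      fix x and B C :: "real set" assume x: "x \<in> \<X>" and B: "B \<in> sets borel" and C: "C \<in> sets borel"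
      let ?w = "\<lambda>\<omega>. of_bool (history t (X \<omega>) = history t x) * history_prob \<X> (\<nu> \<omega>) 1 (history 1 x)"
      let ?w' = "\<lambda>\<omega>. of_bool (X \<omega> 1 = x 1) * history_prob \<X> (\<nu> \<omega>) t (history t x)"
      \<comment> \<open>Here \<open>V\<close> is the variable of the given law and the error is
        \<open>A - V\<close>. Since \<open>A\<close> is a function of \<nu>, the event in
        \<open>A\<close> and the shift are both functions of the pair of \<open>\<nu>\<close> and
        \<open>V\<close>, which the restrictions control on rectangles.\<close>
      define g where "g p = (indicator C (a (fst p)) * indicator B (a (fst p) - snd p) :: real)" for p
      have wm: "?w \<in> borel_measurable M" "?w' \<in> borel_measurable M"
        by (intro borel_measurable_times Xm measurable_compose[OF \<nu>M measurable_history_prob])+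
      have wb: "0 \<le> ?w \<omega>" "?w \<omega> \<le> 1" "0 \<le> ?w' \<omega>" "?w' \<omega> \<le> 1" if "\<omega> \<in> space M" for \<omega>
        using history_prob_01[OF that] by (auto simp: of_bool_def simp del: One_nat_def)
      have gm: "g \<in> borel_measurable (simplex_space \<X> \<Otimes>\<^sub>M borel)"
        unfolding g_def
        by (intro borel_measurable_times measurable_compose[OF _ borel_measurable_indicator[OF C]]
            measurable_compose[OF _ borel_measurable_indicator[OF B]] borel_measurable_diff
            measurable_compose[OF measurable_fst a] measurable_snd)
      have "(\<integral>\<omega>. ?w \<omega> * g (\<nu> \<omega>, V \<omega> t) \<partial>M) = (\<integral>\<omega>. ?w' \<omega> * g (\<nu> \<omega>, V \<omega> 1) \<partial>M)"
      proof (rule integral_weighted_eq_of_rectangles[OF M \<nu>M Vm[OF t1(2)] Vm[OF t1(1)] wm wb _ gm])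
        fix C' and B' :: "real set" assume C': "C' \<in> sets (simplex_space \<X>)" and B': "B' \<in> sets borel"
        have int: "integrable M (\<lambda>\<omega>. u \<omega> * (indicator C' (\<nu> \<omega>) * indicator B' (V \<omega> s)))"
          if s: "s \<in> {1..T}" and u: "u \<in> borel_measurable M" "\<And>\<omega>. \<omega> \<in> space M \<Longrightarrow> 0 \<le> u \<omega>" "\<And>\<omega>. \<omega> \<in> space M \<Longrightarrow> u \<omega> \<le> (1::real)"
          for u s
          by (intro integrable_boundedI[of _ 1] borel_measurable_times u(1) abs_mult_le_of_le_1
              measurable_compose[OF \<nu>M borel_measurable_indicator[OF C']]
              measurable_compose[OF Vm[OF s] borel_measurable_indicator[OF B']])
            (use u in \<open>auto split: split_indicator\<close>)
        have bd: "bounded ((indicator C' :: _ \<Rightarrow> real) ` prob_simplex \<X>)" "bounded (range (indicator B' :: _ \<Rightarrow> real))"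
          unfolding bounded_iff by (auto intro!: exI[of _ 1] split: split_indicator)
        have "0 = (\<integral>\<omega>. indicator C' (\<nu> \<omega>) *
            (indicator B' (V \<omega> t) * of_bool (history t (X \<omega>) = history t x) * history_prob \<X> (\<nu> \<omega>) 1 (history 1 x)
              - indicator B' (V \<omega> 1) * of_bool (X \<omega> 1 = x 1) * history_prob \<X> (\<nu> \<omega>) t (history t x)) \<partial>M)"
          by (rule bspec[OF bspec[OF mp[OF bspec[OF conjunct2[OF \<Gamma>'[OF borel_measurable_indicator[OF C'] bd(1)]]
                borel_measurable_indicator[OF B']] bd(2)] x] t, symmetric])
        also have "\<dots> = (\<integral>\<omega>. ?w \<omega> * (indicator C' (\<nu> \<omega>) * indicator B' (V \<omega> t))
            - ?w' \<omega> * (indicator C' (\<nu> \<omega>) * indicator B' (V \<omega> 1)) \<partial>M)"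
          by (intro Bochner_Integration.integral_cong) (simp_all add: algebra_simps del: One_nat_def)
        also have "\<dots> = (\<integral>\<omega>. ?w \<omega> * (indicator C' (\<nu> \<omega>) * indicator B' (V \<omega> t)) \<partial>M)
            - (\<integral>\<omega>. ?w' \<omega> * (indicator C' (\<nu> \<omega>) * indicator B' (V \<omega> 1)) \<partial>M)"
          by (intro Bochner_Integration.integral_diff int t1 wm wb)
        finally show "(\<integral>\<omega>. ?w \<omega> * (indicator C' (\<nu> \<omega>) * indicator B' (V \<omega> t)) \<partial>M)
            = (\<integral>\<omega>. ?w' \<omega> * (indicator C' (\<nu> \<omega>) * indicator B' (V \<omega> 1)) \<partial>M)" by simp
      qed
      then show "(\<integral>\<omega>. indicator C (A \<omega>) * of_bool (history t (X \<omega>) = history t x) * history_prob \<X> (\<nu> \<omega>) 1 (history 1 x)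
          * indicator B (A \<omega> - V \<omega> t) \<partial>M)
        = (\<integral>\<omega>. indicator C (A \<omega>) * of_bool (X \<omega> 1 = x 1) * history_prob \<X> (\<nu> \<omega>) t (history t x)
          * (indicator B (A \<omega> - V \<omega> 1) :: real) \<partial>M)"
        by (simp add: g_def A_def mult_ac del: One_nat_def)
    qed
    then show "same_cond_distr M borel (\<lambda>\<omega>. (\<lambda>t\<in>{1..T}. A \<omega> - V \<omega> t) t) (history_space t) (\<lambda>\<omega>. (A \<omega>, history t (X \<omega>)))
      (\<lambda>\<omega>. (\<lambda>t\<in>{1..T}. A \<omega> - V \<omega> t) 1) initial_space (\<lambda>\<omega>. (A \<omega>, X \<omega> 1))"
      using t1 by (simp del: One_nat_def)
  qed
  with a that cp show thesis unfolding A_def[abs_def] by blast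
qed

theorem lemma2:
  fixes T :: nat and \<X> :: "(nat \<Rightarrow> 'c) set"
  assumes "1 \<le> T" and "finite \<X>" and "\<X> \<subseteq> {1..T} \<rightarrow>\<^sub>E UNIV"
  shows
    "(\<forall>(M :: 'a measure) X V A \<nu>.
        prob_space M \<longrightarrow>
        X \<in> M \<rightarrow>\<^sub>M count_space \<X> \<longrightarrow>
        V \<in> M \<rightarrow>\<^sub>M (\<Pi>\<^sub>M t\<in>{1..T}. borel) \<longrightarrow>
        A \<in> borel_measurable M \<longrightarrow>
        sequentially_exogenous T \<X> M X V A \<longrightarrow>
        \<nu> \<in> M \<rightarrow>\<^sub>M simplex_space \<X> \<longrightarrow>
        is_cond_prob_path \<X> M X A \<nu> \<longrightarrow>
        distr M (law_space T \<X>) (\<lambda>\<omega>. (X \<omega>, \<lambda>t\<in>{1..T}. A \<omega> - V \<omega> t, \<nu> \<omega>)) \<in> Gamma_laws T \<X>)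
     \<and>
     (\<forall>(M :: 'b measure) X V' \<nu>.
        prob_space M \<longrightarrow>
        X \<in> M \<rightarrow>\<^sub>M count_space \<X> \<longrightarrow>
        V' \<in> M \<rightarrow>\<^sub>M (\<Pi>\<^sub>M t\<in>{1..T}. borel) \<longrightarrow>
        \<nu> \<in> M \<rightarrow>\<^sub>M simplex_space \<X> \<longrightarrow>
        distr M (law_space T \<X>) (\<lambda>\<omega>. (X \<omega>, V' \<omega>, \<nu> \<omega>)) \<in> Gamma_laws T \<X> \<longrightarrow>
        (\<exists>a \<in> borel_measurable (simplex_space \<X>).
           sequentially_exogenous T \<X> M X (\<lambda>\<omega>. \<lambda>t\<in>{1..T}. a (\<nu> \<omega>) - V' \<omega> t) (\<lambda>\<omega>. a (\<nu> \<omega>)) \<and>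
           is_cond_prob_path \<X> M X (\<lambda>\<omega>. a (\<nu> \<omega>)) \<nu>))"
proof (intro conjI allI impI)
  fix M :: "'a measure" and X V A \<nu>
  assume "prob_space M" "X \<in> M \<rightarrow>\<^sub>M count_space \<X>" "V \<in> M \<rightarrow>\<^sub>M (\<Pi>\<^sub>M t\<in>{1..T}. borel)"
    "A \<in> borel_measurable M" "sequentially_exogenous T \<X> M X V A" "\<nu> \<in> M \<rightarrow>\<^sub>M simplex_space \<X>"
    "is_cond_prob_path \<X> M X A \<nu>"
  then show "distr M (law_space T \<X>) (\<lambda>\<omega>. (X \<omega>, \<lambda>t\<in>{1..T}. A \<omega> - V \<omega> t, \<nu> \<omega>)) \<in> Gamma_laws T \<X>"
    by (rule exogenous_imp_Gamma_laws[OF _ assms(2)])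
next
  fix M :: "'b measure" and X V' \<nu>
  assume "prob_space M" "X \<in> M \<rightarrow>\<^sub>M count_space \<X>" "V' \<in> M \<rightarrow>\<^sub>M (\<Pi>\<^sub>M t\<in>{1..T}. borel)"
    "\<nu> \<in> M \<rightarrow>\<^sub>M simplex_space \<X>"
    "distr M (law_space T \<X>) (\<lambda>\<omega>. (X \<omega>, V' \<omega>, \<nu> \<omega>)) \<in> Gamma_laws T \<X>"
  from Gamma_laws_imp_exogenous[OF this(1) assms(2) this(2-5)]
  obtain a where "a \<in> borel_measurable (simplex_space \<X>)"
    "sequentially_exogenous T \<X> M X (\<lambda>\<omega>. \<lambda>t\<in>{1..T}. a (\<nu> \<omega>) - V' \<omega> t) (\<lambda>\<omega>. a (\<nu> \<omega>))"
    "is_cond_prob_path \<X> M X (\<lambda>\<omega>. a (\<nu> \<omega>)) \<nu>" .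
  then show "\<exists>a \<in> borel_measurable (simplex_space \<X>).
      sequentially_exogenous T \<X> M X (\<lambda>\<omega>. \<lambda>t\<in>{1..T}. a (\<nu> \<omega>) - V' \<omega> t) (\<lambda>\<omega>. a (\<nu> \<omega>)) \<and>
      is_cond_prob_path \<X> M X (\<lambda>\<omega>. a (\<nu> \<omega>)) \<nu>"
    by (intro bexI conjI)
qed

end
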